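(* Let $\varepsilon>0$ be a constant and let $p=\frac{1+\varepsilon}{k}$. There exists a constant $c=c(\varepsilon)>0$ such that the following holds: for every graph $G$ with minimum degree $\delta(G)\ge k$, with probability tending to $1$ as $k\to\infty$ (uniformly over all such $G$), \[ h(G_p)\ \ge\ c\sqrt{\frac{k}{\log k}}. \] That is, with high probability $h(G_p)=\Omega\!\left(\sqrt{k/\log k}\right)$.
   Context: For a graph $G$ and $p\in[0,1]$, $G_p$ denotes the random subgraph of $G$ on the same vertex set obtained by retaining each edge of $G$ independently with probability $p$. $h(H)$ denotes the Hadwiger number of a graph $H$, i.e. the largest $t$ such that $H$ contains $K_t$ as a minor. $\log$ is the natural logarithm. "With high probability" means with probability tending to $1$ as $k\to\infty$; all asymptotics are as $k\to\infty$. *)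

theory Defs
  imports "HOL-Probability.Probability" "HOL-Library.Ramsey"
begin

text \<open>An edge is the two-element set of its end vertices.\<close>

datatype 'a ugraph = UGraph (verts: "'a set") (edges: "'a set set")

definition finite_simple_graph :: "'a ugraph \<Rightarrow> bool" where
  "finite_simple_graph G \<longleftrightarrow> finite (verts G) \<and> verts G \<noteq> {} \<and> edges G \<subseteq> [verts G]\<^bsup>2\<^esup>"

definition vertex_degree :: "'a ugraph \<Rightarrow> 'a \<Rightarrow> nat" where
  "vertex_degree G v = card {e \<in> edges G. v \<in> e}"

definition min_degree :: "'a ugraph \<Rightarrow> nat" where
  "min_degree G = Min (vertex_degree G ` verts G)"

definition induced_connected :: "'a ugraph \<Rightarrow> 'a set \<Rightarrow> bool" where
  "induced_connected G B \<longleftrightarrow> B \<noteq> {} \<and> B \<subseteq> verts G \<and>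
     (\<forall>u\<in>B. \<forall>v\<in>B. (u, v) \<in> {(x, y). x \<in> B \<and> y \<in> B \<and> {x, y} \<in> edges G}\<^sup>*)"

text \<open>\<open>M x\<close> is the branch set of the vertex \<open>x\<close> of \<open>H\<close>: contracting every branch set of a
  suitable subgraph of \<open>G\<close> to a single vertex yields \<open>H\<close>.\<close>

definition is_minor :: "'b ugraph \<Rightarrow> 'a ugraph \<Rightarrow> bool" where
  "is_minor H G \<longleftrightarrow> (\<exists>M :: 'b \<Rightarrow> 'a set.
     (\<forall>x\<in>verts H. induced_connected G (M x)) \<and>
     (\<forall>x\<in>verts H. \<forall>y\<in>verts H. x \<noteq> y \<longrightarrow> M x \<inter> M y = {}) \<and>
     (\<forall>x\<in>verts H. \<forall>y\<in>verts H. {x, y} \<in> edges H \<longrightarrow>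
        (\<exists>u\<in>M x. \<exists>v\<in>M y. {u, v} \<in> edges G)))"

definition complete_graph :: "nat \<Rightarrow> nat ugraph" where
  "complete_graph t = UGraph {..<t} ([{..<t}]\<^bsup>2\<^esup>)"

definition hadwiger :: "'a ugraph \<Rightarrow> nat" where
  "hadwiger G = Max {t. is_minor (complete_graph t) G}"

text \<open>The maximum is over a nonempty finite set, so it is the actual largest order.\<close>

lemma is_minor_complete_graph_0: "is_minor (complete_graph 0) G"
  by (simp add: is_minor_def complete_graph_def)

lemma is_minor_complete_graph_le:
  assumes "finite (verts G)" "is_minor (complete_graph t) G"
  shows "t \<le> card (verts G)"
proof -
  obtain M where M: "\<And>x. x < t \<Longrightarrow> induced_connected G (M x)"
    and disj: "\<And>x y. x < t \<Longrightarrow> y < t \<Longrightarrow> x \<noteq> y \<Longrightarrow> M x \<inter> M y = {}"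
    using assms(2) unfolding is_minor_def complete_graph_def ugraph.sel Ball_def lessThan_iff by metis
  have "\<forall>x. \<exists>v. x < t \<longrightarrow> v \<in> M x"
    using M unfolding induced_connected_def by blast
  then obtain f where f: "\<And>x. x < t \<Longrightarrow> f x \<in> M x" by metis
  have "inj_on f {..<t}"
    using f disj by (fastforce simp: inj_on_def)
  moreover have "f ` {..<t} \<subseteq> verts G"
    using f M unfolding induced_connected_def by blast
  ultimately show ?thesis
    using card_inj_on_le[of f "{..<t}" "verts G"] assms(1) by simp
qed

lemma finite_complete_minors:
  "finite (verts G) \<Longrightarrow> finite {t. is_minor (complete_graph t) G}"
  by (rule finite_subset[of _ "{..card (verts G)}"]) (auto dest: is_minor_complete_graph_le)

text \<open>For \<open>p\<close> outside the unit interval, \<^const>\<open>bernoulli_pmf\<close> clamps \<open>p\<close> to it.\<close>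

definition random_subgraph :: "'a ugraph \<Rightarrow> real \<Rightarrow> 'a ugraph pmf" where
  "random_subgraph G p =
     map_pmf (\<lambda>kept. UGraph (verts G) {e \<in> edges G. kept e})
       (Pi_pmf (edges G) False (\<lambda>_. bernoulli_pmf p))"

end

theory Submission
  imports Defs
begin

text \<open>
  Expose the edges in two rounds. In the first round, with edge probability \<open>(1 + \<epsilon>/2)/k\<close>, explore trees
  with a bounded number of children per vertex and stop once the touched set \<open>R\<close> spans at least
  \<open>c k |R|\<close> edges of \<open>G\<close>. As long as \<open>R\<close> spans fewer edges, nearly all edges at \<open>R\<close> lead to fresh
  vertices, so the exploration is supercritical and, except for an initial phase, cannot die out;
  it stops at the latest when \<open>R\<close> is the whole vertex set. This uses only the degrees of
  the touched vertices, so large degrees in \<open>G\<close> do no harm.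

  Cut the resulting tree into connected pieces of size \<open>\<Theta>(\<surd>k)\<close>. Two pieces are joined by \<open>O(k)\<close> edges of
  \<open>G\<close>, so in the second round, with edge probability \<open>\<Theta>(1/k)\<close>, a constant proportion of the
  new edges join different pairs of pieces, and contracting the pieces gives a graph of average
  degree \<open>\<Omega>(\<surd>k)\<close>. By the theorem of Kostochka and Thomason, proved here along the lines of
  Alon, Krivelevich and Sudakov, average degree \<open>d\<close> forces a complete minor of order \<open>\<Omega>(d/\<surd>log d)\<close>.
\<close>

section \<open>Graphs and minors\<close>

text \<open>Neither the order nor the maximum degree of G is bounded in terms of k, so a union bound
  over the vertices of G is out of reach: both rounds must fail with probability exponentially small
  in k, whatever G is. This is why everything is charged to the touched set: R spans c k |R| edges
  only if |R| \<ge> 2 c k, and that much room gives the concentration. The cap on the number of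
  children lets the tree be cut into pieces of comparable size, which is impossible for a star. Its
  price is that up to |R| / D vertices stop asking early; this costs a share 1 / D of the edges and
  is paid out of \<epsilon>. The size \<surd>k balances two demands. Pieces of L vertices give at
  most |T| / L contracted vertices for a number of new edges of order |T|, hence degree of order L,
  as long as these edges are not wasted on the same pairs. A pair receives up to order L * L / k new
  edges on average, which stays bounded exactly up to L of order \<surd>k. With d of order \<surd>k,
  the loss \<surd>log d of the extremal theorem becomes \<surd>log k.\<close>

lemma doubleton_in_nsets2_iff: "{x, y} \<in> [A]\<^bsup>2\<^esup> \<longleftrightarrow> x \<in> A \<and> y \<in> A \<and> x \<noteq> y"
  by (auto simp: nsets_def card_2_iff doubleton_eq_iff)

lemma in_nsets2E:
  assumes "e \<in> [A]\<^bsup>2\<^esup>"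
  obtains x y where "e = {x, y}" "x \<in> A" "y \<in> A" "x \<noteq> y"
  using assms by (auto simp: nsets_def card_2_iff)

lemma edge_vertices:
  assumes "E \<subseteq> [V]\<^bsup>2\<^esup>" "{x, y} \<in> E"
  shows "x \<in> V" "y \<in> V" "x \<noteq> y"
  using subsetD[OF assms] unfolding doubleton_in_nsets2_iff by auto

section \<open>Neighbourhoods and the edges inside a vertex set\<close>

definition nbhd :: "'a set set \<Rightarrow> 'a \<Rightarrow> 'a set" where
  "nbhd E v = {w. {v, w} \<in> E}"

definition edges_in :: "'a set set \<Rightarrow> 'a set \<Rightarrow> 'a set set" where
  "edges_in E S = {e \<in> E. e \<subseteq> S}"

lemma nbhd_sym: "w \<in> nbhd E v \<longleftrightarrow> v \<in> nbhd E w"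
  by (simp add: nbhd_def insert_commute)

lemma nbhd_subset: "E \<subseteq> [V]\<^bsup>2\<^esup> \<Longrightarrow> nbhd E v \<subseteq> V - {v}"
  using edge_vertices[of E V v] by (auto simp: nbhd_def)

lemma finite_edges: "finite V \<Longrightarrow> E \<subseteq> [V]\<^bsup>2\<^esup> \<Longrightarrow> finite E"
  by (meson finite_imp_finite_nsets finite_subset)

lemma card_incident_edges:
  assumes "E \<subseteq> [V]\<^bsup>2\<^esup>"
  shows "card {e \<in> E. v \<in> e} = card (nbhd E v)"
proof -
  have "bij_betw (\<lambda>w. {v, w}) (nbhd E v) {e \<in> E. v \<in> e}"
  proof (intro bij_betwI')
    fix e assume e: "e \<in> {e \<in> E. v \<in> e}"
    then have "e \<in> [V]\<^bsup>2\<^esup>" using assms by auto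
    then obtain x y where "e = {x, y}" by (rule in_nsets2E)
    then show "\<exists>w\<in>nbhd E v. e = {v, w}"
      using e unfolding nbhd_def by (auto simp: insert_commute)
  qed (auto simp: nbhd_def doubleton_eq_iff)
  then show ?thesis using bij_betw_same_card by metis
qed

lemma card_edges_remove_vertex:
  assumes "finite V" "E \<subseteq> [V]\<^bsup>2\<^esup>"
  shows "card E = card {e \<in> E. v \<notin> e} + card (nbhd E v)"
proof -
  have "E = {e \<in> E. v \<notin> e} \<union> {e \<in> E. v \<in> e}" by auto
  then have "card E = card {e \<in> E. v \<notin> e} + card {e \<in> E. v \<in> e}"
    using finite_edges[OF assms] by (metis (no_types, lifting) card_Un_disjoint disjoint_iff finite_Un mem_Collect_eq)
  then show ?thesis using card_incident_edges[OF assms(2)] by simp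
qed

lemma handshake:
  assumes "finite V" "E \<subseteq> [V]\<^bsup>2\<^esup>"
  shows "(\<Sum>v\<in>V. card (nbhd E v)) = 2 * card E"
proof -
  have "(\<Sum>v\<in>V. card {e \<in> E. v \<in> e}) = 2 * card E"
  proof (rule sum_multicount)
    show "\<forall>e\<in>E. card {v \<in> V. v \<in> e} = 2"
    proof
      fix e assume "e \<in> E"
      then have "e \<subseteq> V" "card e = 2" using assms(2) by (auto simp: nsets_def)
      then have "{v \<in> V. v \<in> e} = e" by auto
      then show "card {v \<in> V. v \<in> e} = 2" using \<open>card e = 2\<close> by simp
    qed
  qed (use assms finite_edges in auto)
  then show ?thesis using card_incident_edges[OF assms(2)] by simp
qed

lemma edges_in_nsets2: "E \<subseteq> [V]\<^bsup>2\<^esup> \<Longrightarrow> edges_in E S \<subseteq> [S]\<^bsup>2\<^esup>"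
  by (auto simp: edges_in_def nsets_def)

lemma nbhd_edges_in: "v \<in> S \<Longrightarrow> nbhd (edges_in E S) v = nbhd E v \<inter> S"
  by (auto simp: nbhd_def edges_in_def)

lemma handshake_in:
  assumes "finite S" "E \<subseteq> [V]\<^bsup>2\<^esup>"
  shows "(\<Sum>v\<in>S. card (nbhd E v \<inter> S)) = 2 * card (edges_in E S)"
  using handshake[OF assms(1) edges_in_nsets2[OF assms(2)]] by (simp add: nbhd_edges_in)

lemma card_edges_in_remove:
  assumes "finite S" "E \<subseteq> [V]\<^bsup>2\<^esup>" "v \<in> S"
  shows "card (edges_in E S) = card (edges_in E (S - {v})) + card (nbhd E v \<inter> S)"
proof -
  have "{e \<in> edges_in E S. v \<notin> e} = edges_in E (S - {v})" by (auto simp: edges_in_def)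
  then show ?thesis
    using card_edges_remove_vertex[OF assms(1) edges_in_nsets2[OF assms(2)], of v] nbhd_edges_in[OF assms(3)]
    by metis
qed

section \<open>Connected vertex sets and the composition of minors\<close>

definition conn :: "'a set set \<Rightarrow> 'a set \<Rightarrow> bool" where
  "conn E B \<longleftrightarrow> B \<noteq> {} \<and> (\<forall>u\<in>B. \<forall>v\<in>B. (u, v) \<in> {(x, y). x \<in> B \<and> y \<in> B \<and> {x, y} \<in> E}\<^sup>*)"

lemma connI:
  assumes "B \<noteq> {}"
    and "\<And>u v. u \<in> B \<Longrightarrow> v \<in> B \<Longrightarrow> (u, v) \<in> {(x, y). x \<in> B \<and> y \<in> B \<and> {x, y} \<in> E}\<^sup>*"
  shows "conn E B"
  using assms unfolding conn_def by simp

lemma connD: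
  assumes "conn E B" "u \<in> B" "v \<in> B"
  shows "(u, v) \<in> {(x, y). x \<in> B \<and> y \<in> B \<and> {x, y} \<in> E}\<^sup>*"
  using assms unfolding conn_def by simp

lemma conn_nonempty: "conn E B \<Longrightarrow> B \<noteq> {}"
  by (simp add: conn_def)

lemma induced_connected_iff: "induced_connected G B \<longleftrightarrow> conn (edges G) B \<and> B \<subseteq> verts G"
  by (auto simp: induced_connected_def conn_def)

lemma conn_singleton: "conn E {x}"
  by (simp add: conn_def)

lemma conn_mono:
  assumes "conn E B" "E \<subseteq> F"
  shows "conn F B"
proof -
  have "{(x, y). x \<in> B \<and> y \<in> B \<and> {x, y} \<in> E}\<^sup>* \<subseteq> {(x, y). x \<in> B \<and> y \<in> B \<and> {x, y} \<in> F}\<^sup>*"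
    using assms(2) by (intro rtrancl_mono) auto
  then show ?thesis using connD[OF assms(1)] conn_nonempty[OF assms(1)] by (intro connI) auto
qed

text \<open>A walk in the index graph lifts: inside each \<open>B j\<close> one walks to the end of
  an edge that leads to the next set. With a graph as index relation this makes a union of branch
  sets along a branch set connected, so that minors compose.\<close>

lemma conn_family_Union:
  assumes I: "conn R I" and B: "\<And>i. i \<in> I \<Longrightarrow> conn E (B i)"
    and adj: "\<And>i j. i \<in> I \<Longrightarrow> j \<in> I \<Longrightarrow> {i, j} \<in> R \<Longrightarrow> \<exists>u\<in>B i. \<exists>v\<in>B j. {u, v} \<in> E"
  shows "conn E (\<Union>i\<in>I. B i)"
proof -
  let ?U = "\<Union>i\<in>I. B i"
  let ?r = "{(x, y). x \<in> ?U \<and> y \<in> ?U \<and> {x, y} \<in> E}"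
  have inside: "(u, v) \<in> ?r\<^sup>*" if "i \<in> I" "u \<in> B i" "v \<in> B i" for i u v
  proof -
    have "{(x, y). x \<in> B i \<and> y \<in> B i \<and> {x, y} \<in> E} \<subseteq> ?r" using that by auto
    moreover have "(u, v) \<in> {(x, y). x \<in> B i \<and> y \<in> B i \<and> {x, y} \<in> E}\<^sup>*"
      by (rule connD[OF B[OF that(1)] that(2,3)])
    ultimately show ?thesis using rtrancl_mono by blast
  qed
  have "\<forall>u\<in>B i. \<forall>v\<in>B j. (u, v) \<in> ?r\<^sup>*" if "i \<in> I" "j \<in> I" for i j
  proof -
    have "(i, j) \<in> {(x, y). x \<in> I \<and> y \<in> I \<and> {x, y} \<in> R}\<^sup>*"
      by (rule connD[OF I that])
    then show ?thesis
    proof (induction)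
      case base then show ?case using inside that by blast
    next
      case (step j l)
      then obtain a b where ab: "a \<in> B j" "b \<in> B l" "{a, b} \<in> E" "j \<in> I" "l \<in> I" using adj by blast
      then have "(a, b) \<in> ?r" by auto
      then show ?case using step.IH ab inside[of l b] by (meson rtrancl.rtrancl_into_rtrancl rtrancl_trans)
    qed
  qed
  note path = this
  obtain i where "i \<in> I" using conn_nonempty[OF I] by auto
  then have "?U \<noteq> {}" using conn_nonempty[OF B] by auto
  then show ?thesis
  proof (rule connI)
    fix u v assume "u \<in> ?U" "v \<in> ?U"
    then obtain i j where "i \<in> I" "j \<in> I" "u \<in> B i" "v \<in> B j" by auto
    then show "(u, v) \<in> ?r\<^sup>*" using path by simp
  qed
qed

text \<open>The disjunction covers both uses: sets that share a vertex, when paths are collected,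
  and sets joined by an edge, when a vertex or a bag is attached.\<close>

lemma conn_Un:
  assumes "conn E A" "conn E B" "u \<in> A" "v \<in> B" "u = v \<or> {u, v} \<in> E"
  shows "conn E (A \<union> B)"
proof -
  let ?r = "{(x, y). x \<in> A \<union> B \<and> y \<in> A \<union> B \<and> {x, y} \<in> E}"
  have A: "(x, y) \<in> ?r\<^sup>*" if "x \<in> A" "y \<in> A" for x y
    using connD[OF assms(1) that] rtrancl_mono[of "{(x, y). x \<in> A \<and> y \<in> A \<and> {x, y} \<in> E}" ?r] by auto
  have B: "(x, y) \<in> ?r\<^sup>*" if "x \<in> B" "y \<in> B" for x y
    using connD[OF assms(2) that] rtrancl_mono[of "{(x, y). x \<in> B \<and> y \<in> B \<and> {x, y} \<in> E}" ?r] by auto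
  have uv: "(u, v) \<in> ?r\<^sup>*" "(v, u) \<in> ?r\<^sup>*"
    using assms(3-5) by (auto simp: insert_commute)
  have "(x, y) \<in> ?r\<^sup>*" if "x \<in> A \<union> B" "y \<in> A \<union> B" for x y
    using that A[of x u] A[of u y] B[of x v] B[of v y] A[of x y] B[of x y] uv assms(3,4)
    by (auto intro: rtrancl_trans)
  then show ?thesis using assms(3) by (intro connI) auto
qed

lemma is_minor_iff:
  "is_minor H G \<longleftrightarrow> (\<exists>M.
     (\<forall>x\<in>verts H. conn (edges G) (M x) \<and> M x \<subseteq> verts G) \<and>
     (\<forall>x\<in>verts H. \<forall>y\<in>verts H. x \<noteq> y \<longrightarrow> M x \<inter> M y = {}) \<and>
     (\<forall>x\<in>verts H. \<forall>y\<in>verts H. {x, y} \<in> edges H \<longrightarrow> (\<exists>u\<in>M x. \<exists>v\<in>M y. {u, v} \<in> edges G)))"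
  unfolding is_minor_def induced_connected_iff ..

lemma is_minorE:
  assumes "is_minor H G"
  obtains M where "\<And>x. x \<in> verts H \<Longrightarrow> conn (edges G) (M x)" "\<And>x. x \<in> verts H \<Longrightarrow> M x \<subseteq> verts G"
    "\<And>x y. x \<in> verts H \<Longrightarrow> y \<in> verts H \<Longrightarrow> x \<noteq> y \<Longrightarrow> M x \<inter> M y = {}"
    "\<And>x y. x \<in> verts H \<Longrightarrow> y \<in> verts H \<Longrightarrow> {x, y} \<in> edges H \<Longrightarrow> \<exists>u\<in>M x. \<exists>v\<in>M y. {u, v} \<in> edges G"
proof -
  from assms obtain M where M: "(\<forall>x\<in>verts H. conn (edges G) (M x) \<and> M x \<subseteq> verts G) \<and>
     (\<forall>x\<in>verts H. \<forall>y\<in>verts H. x \<noteq> y \<longrightarrow> M x \<inter> M y = {}) \<and>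
     (\<forall>x\<in>verts H. \<forall>y\<in>verts H. {x, y} \<in> edges H \<longrightarrow> (\<exists>u\<in>M x. \<exists>v\<in>M y. {u, v} \<in> edges G))"
    unfolding is_minor_iff by (elim exE)
  show thesis by (rule that[of M]) (use M in simp_all)
qed

lemma is_minor_trans:
  assumes "is_minor H G" "is_minor G F"
  shows "is_minor H F"
proof -
  obtain M where M: "\<And>x. x \<in> verts H \<Longrightarrow> conn (edges G) (M x)" "\<And>x. x \<in> verts H \<Longrightarrow> M x \<subseteq> verts G"
    "\<And>x y. x \<in> verts H \<Longrightarrow> y \<in> verts H \<Longrightarrow> x \<noteq> y \<Longrightarrow> M x \<inter> M y = {}"
    "\<And>x y. x \<in> verts H \<Longrightarrow> y \<in> verts H \<Longrightarrow> {x, y} \<in> edges H \<Longrightarrow> \<exists>u\<in>M x. \<exists>v\<in>M y. {u, v} \<in> edges G"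
    by (rule is_minorE[OF assms(1)]) blast
  obtain N where N: "\<And>x. x \<in> verts G \<Longrightarrow> conn (edges F) (N x)" "\<And>x. x \<in> verts G \<Longrightarrow> N x \<subseteq> verts F"
    "\<And>x y. x \<in> verts G \<Longrightarrow> y \<in> verts G \<Longrightarrow> x \<noteq> y \<Longrightarrow> N x \<inter> N y = {}"
    "\<And>x y. x \<in> verts G \<Longrightarrow> y \<in> verts G \<Longrightarrow> {x, y} \<in> edges G \<Longrightarrow> \<exists>u\<in>N x. \<exists>v\<in>N y. {u, v} \<in> edges F"
    by (rule is_minorE[OF assms(2)]) blast
  show ?thesis unfolding is_minor_iff
  proof (intro exI[of _ "\<lambda>x. \<Union>u\<in>M x. N u"] conjI ballI impI)
    fix x assume x: "x \<in> verts H"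
    show "conn (edges F) (\<Union>u\<in>M x. N u)"
    proof (rule conn_family_Union[OF M(1)[OF x]])
      show "conn (edges F) (N i)" if "i \<in> M x" for i using that M(2)[OF x] N(1) by blast
      show "\<exists>u\<in>N i. \<exists>v\<in>N j. {u, v} \<in> edges F" if "i \<in> M x" "j \<in> M x" "{i, j} \<in> edges G" for i j
        using that M(2)[OF x] N(4) by blast
    qed
    show "(\<Union>u\<in>M x. N u) \<subseteq> verts F" using M(2)[OF x] N(2) by blast
  next
    fix x y assume xy: "x \<in> verts H" "y \<in> verts H" "x \<noteq> y"
    have "N u \<inter> N v = {}" if "u \<in> M x" "v \<in> M y" for u v
      using that M(2)[OF xy(1)] M(2)[OF xy(2)] M(3)[OF xy] N(3)[of u v] by auto
    then show "(\<Union>u\<in>M x. N u) \<inter> (\<Union>u\<in>M y. N u) = {}" by blast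
  next
    fix x y assume xy: "x \<in> verts H" "y \<in> verts H" "{x, y} \<in> edges H"
    obtain u v where "u \<in> M x" "v \<in> M y" "{u, v} \<in> edges G" using M(4)[OF xy] by blast
    moreover then obtain a b where "a \<in> N u" "b \<in> N v" "{a, b} \<in> edges F"
      using N(4)[of u v] M(2) xy by blast
    ultimately show "\<exists>u\<in>\<Union>u\<in>M x. N u. \<exists>v\<in>\<Union>u\<in>M y. N u. {u, v} \<in> edges F" by blast
  qed
qed

lemma is_minor_subgraph: "W \<subseteq> V \<Longrightarrow> F \<subseteq> E \<Longrightarrow> is_minor (UGraph W F) (UGraph V E)"
  unfolding is_minor_iff by (rule exI[of _ "\<lambda>x. {x}"]) (auto simp: conn_singleton)

text \<open>\<open>y\<close> is merged into \<open>x\<close> and deleted. As edges are sets, the two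
  edges to a common neighbour become one by themselves; \<open>x\<close> is left out of the image to
  avoid a loop.\<close>

definition contract :: "'a set set \<Rightarrow> 'a \<Rightarrow> 'a \<Rightarrow> 'a set set" where
  "contract E x y = {e \<in> E. y \<notin> e} \<union> (\<lambda>w. {x, w}) ` (nbhd E y - {x})"

lemma is_minor_contract:
  assumes E: "E \<subseteq> [V]\<^bsup>2\<^esup>" and xy: "{x, y} \<in> E"
  shows "is_minor (UGraph (V - {y}) (contract E x y)) (UGraph V E)"
proof -
  have V: "x \<in> V" "y \<in> V" "x \<noteq> y" using edge_vertices[OF E xy] by auto
  have "conn E ({x} \<union> {y})" by (rule conn_Un[OF conn_singleton conn_singleton, of x x y y]) (use xy in auto)
  then have c: "conn E {x, y}" by (simp add: insert_commute)
  let ?M = "\<lambda>u. if u = x then {x, y} else {u}"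
  have "\<exists>a\<in>?M u. \<exists>b\<in>?M v. {a, b} \<in> E" if uv: "{u, v} \<in> contract E x y" for u v
  proof (cases "{u, v} \<in> E")
    case True then show ?thesis by auto
  next
    case False
    then obtain w where w: "{u, v} = {x, w}" "{y, w} \<in> E" "w \<noteq> x"
      using uv by (auto simp: contract_def nbhd_def)
    then have "u = x \<and> v = w \<or> u = w \<and> v = x" by (auto simp: doubleton_eq_iff)
    then show ?thesis using w(2,3) by (auto simp: insert_commute)
  qed
  note adj = this
  have "?M u \<subseteq> V \<and> conn E (?M u)" if "u \<in> V - {y}" for u
    using that c V by (simp add: conn_singleton)
  moreover have "?M u \<inter> ?M v = {}" if "u \<in> V - {y}" "v \<in> V - {y}" "u \<noteq> v" for u v
    using that V by auto
  ultimately show ?thesis unfolding is_minor_iff using adj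
    by (intro exI[of _ ?M]) (simp only: ugraph.sel, blast)
qed

lemma contract_nsets2:
  assumes E: "E \<subseteq> [V]\<^bsup>2\<^esup>" and xy: "{x, y} \<in> E"
  shows "contract E x y \<subseteq> [V - {y}]\<^bsup>2\<^esup>"
proof
  have V: "x \<in> V" "y \<in> V" "x \<noteq> y" using edge_vertices[OF E xy] by auto
  fix e assume "e \<in> contract E x y"
  then consider "e \<in> E" "y \<notin> e" | w where "e = {x, w}" "w \<in> nbhd E y" "w \<noteq> x"
    by (auto simp: contract_def)
  then show "e \<in> [V - {y}]\<^bsup>2\<^esup>"
  proof cases
    case 1 then show ?thesis using E by (auto simp: nsets_def)
  next
    case 2 then show ?thesis using V nbhd_subset[OF E, of y] by (auto simp: doubleton_in_nsets2_iff)
  qed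
qed

text \<open>The contracted edge disappears, and for each common neighbour \<open>w\<close> the edges
  \<open>{x, w}\<close> and \<open>{y, w}\<close> fall together; nothing else is lost. So an edge in
  fewer than \<open>d\<close> triangles can be contracted at a cost of at most \<open>d\<close>
  edges.\<close>

lemma card_contract:
  assumes V: "finite V" and E: "E \<subseteq> [V]\<^bsup>2\<^esup>" and xy: "{x, y} \<in> E"
  shows "card E = card (contract E x y) + 1 + card (nbhd E x \<inter> nbhd E y)"
proof -
  have fE: "finite E" and fN: "finite (nbhd E y)"
    using finite_edges[OF V E] nbhd_subset[OF E] V by (auto intro: finite_subset)
  have nxy: "x \<noteq> y" using edge_vertices[OF E xy] by auto
  let ?N = "nbhd E y - {x} - nbhd E x"
  have "contract E x y = {e \<in> E. y \<notin> e} \<union> (\<lambda>w. {x, w}) ` ?N"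
    using nbhd_subset[OF E, of y] nxy by (auto simp: contract_def nbhd_def)
  moreover have "{e \<in> E. y \<notin> e} \<inter> (\<lambda>w. {x, w}) ` ?N = {}" by (auto simp: nbhd_def)
  moreover have "card ((\<lambda>w. {x, w}) ` ?N) = card ?N"
    by (rule card_image) (auto simp: inj_on_def doubleton_eq_iff)
  ultimately have c: "card (contract E x y) = card {e \<in> E. y \<notin> e} + card ?N"
    using fE fN by (simp add: card_Un_disjoint)
  have "nbhd E y = insert x (?N \<union> (nbhd E x \<inter> nbhd E y))"
    using xy by (auto simp: nbhd_def insert_commute)
  moreover have "x \<notin> ?N \<union> (nbhd E x \<inter> nbhd E y)" using nbhd_subset[OF E, of x] by auto
  ultimately have "card (nbhd E y) = Suc (card (?N \<union> (nbhd E x \<inter> nbhd E y)))"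
    using fN by (metis card_insert_disjoint finite_insert)
  also have "card (?N \<union> (nbhd E x \<inter> nbhd E y)) = card ?N + card (nbhd E x \<inter> nbhd E y)"
    using fN by (intro card_Un_disjoint) auto
  finally show ?thesis using c card_edges_remove_vertex[OF V E, of y] by simp
qed

text \<open>In a minor-minimal graph with at least \<open>d\<close> edges per vertex every edge lies in \<open>d\<close> triangles,
  so the neighbourhood of a vertex of at most average degree is dense.\<close>

lemma dense_minor_of_small_order:
  fixes E :: "'a set set" and d :: nat
  assumes "finite V" "E \<subseteq> [V]\<^bsup>2\<^esup>" "V \<noteq> {}" "d * card V \<le> card E" "d \<ge> 1"
  shows "\<exists>(W :: 'a set) F. finite W \<and> W \<noteq> {} \<and> F \<subseteq> [W]\<^bsup>2\<^esup> \<and> card W \<le> 2 * d \<and>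
    (\<forall>w\<in>W. d \<le> card (nbhd F w)) \<and> is_minor (UGraph W F) (UGraph V E)"
  using assms
proof (induction "card V + card E" arbitrary: V E rule: less_induct)
  case less
  note V = less.prems(1) and E = less.prems(2) and ne = less.prems(3) and de = less.prems(4)
  have fE: "finite E" by (rule finite_edges[OF V E])
  have step: ?case if m: "is_minor (UGraph V' E') (UGraph V E)" and "finite V'" "E' \<subseteq> [V']\<^bsup>2\<^esup>"
    "V' \<noteq> {}" "d * card V' \<le> card E'" "card V' + card E' < card V + card E"
    for V' :: "'a set" and E' :: "'a set set"
    using less.hyps[OF that(6,2,3,4,5)] less.prems(5) is_minor_trans[OF _ m] by blast
  have cV: "card V \<ge> 1" using V ne by (simp add: Suc_leI card_gt_0_iff)
  have cE: "card E \<ge> 1" using de cV less.prems(5) by (metis mult_le_mono nat_mult_1 order_trans)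
  have big: "V - {v} \<noteq> {}" for v
  proof
    assume "V - {v} = {}"
    then have "E \<subseteq> [{v}]\<^bsup>2\<^esup>" using E nsets_mono[of V "{v}" 2] by blast
    then have "E = {}" by (auto elim: in_nsets2E)
    then show False using cE by simp
  qed
  \<comment> \<open>Each of the first three cases yields a smaller minor that still has
    \<open>d\<close> edges per vertex: a surplus edge goes, or one vertex goes together with at most
    \<open>d\<close> edges. When none applies, the edge count is an equality and the average degree
    is exactly \<open>2 * d\<close>.\<close>
  consider (edge) "d * card V < card E" | (vertex) v where "v \<in> V" "card (nbhd E v) \<le> d"
    | (contr) x y where "{x, y} \<in> E" "card (nbhd E x \<inter> nbhd E y) < d"
    | (final) "card E = d * card V" "\<And>v. v \<in> V \<Longrightarrow> d < card (nbhd E v)"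
       "\<And>x y. {x, y} \<in> E \<Longrightarrow> d \<le> card (nbhd E x \<inter> nbhd E y)"
    using de by (meson le_neq_implies_less not_le)
  then show ?case
  proof cases
    case edge
    obtain e where e: "e \<in> E" using cE by (metis card.empty ex_in_conv not_one_le_zero)
    have "card (E - {e}) = card E - 1" using e fE by simp
    then have "d * card V \<le> card (E - {e})" "card V + card (E - {e}) < card V + card E"
      using edge cE by linarith+
    moreover have "is_minor (UGraph V (E - {e})) (UGraph V E)" by (intro is_minor_subgraph) auto
    moreover have "E - {e} \<subseteq> [V]\<^bsup>2\<^esup>" using E by blast
    ultimately show ?thesis by (intro step[OF _ V _ ne])
  next
    case vertex
    let ?E = "{e \<in> E. v \<notin> e}"
    have cc: "card E = card ?E + card (nbhd E v)" by (rule card_edges_remove_vertex[OF V E])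
    have c: "card (V - {v}) = card V - 1" using vertex(1) V by simp
    have "d * card (V - {v}) \<le> card ?E" "card (V - {v}) + card ?E < card V + card E"
      using cc c cV vertex(2) de by (simp_all add: diff_mult_distrib2)
    moreover have "is_minor (UGraph (V - {v}) ?E) (UGraph V E)" by (intro is_minor_subgraph) auto
    moreover have "?E \<subseteq> [V - {v}]\<^bsup>2\<^esup>" using E by (auto simp: nsets_def)
    moreover have "finite (V - {v})" using V by simp
    ultimately show ?thesis by (intro step[OF _ _ _ big])
  next
    case contr
    have yV: "y \<in> V" using edge_vertices[OF E contr(1)] by auto
    have cc: "card E = card (contract E x y) + 1 + card (nbhd E x \<inter> nbhd E y)"
      by (rule card_contract[OF V E contr(1)])
    have c: "card (V - {y}) = card V - 1" using yV V by simp
    have "d * card (V - {y}) \<le> card (contract E x y)"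
      "card (V - {y}) + card (contract E x y) < card V + card E"
      using cc c cV contr(2) de by (simp_all add: diff_mult_distrib2)
    moreover have "finite (V - {y})" using V by simp
    ultimately show ?thesis
      using is_minor_contract[OF E contr(1)] contract_nsets2[OF E contr(1)] by (intro step[OF _ _ _ big])
  next
    case final
    have "\<exists>v\<in>V. card (nbhd E v) \<le> 2 * d"
    proof (rule ccontr)
      assume "\<not> ?thesis"
      then have "(\<Sum>v\<in>V. 2 * d) < (\<Sum>v\<in>V. card (nbhd E v))"
        using V ne by (intro sum_strict_mono) auto
      then show False using handshake[OF V E] final(1) by simp
    qed
    then obtain v where v: "v \<in> V" "card (nbhd E v) \<le> 2 * d" by blast
    let ?W = "nbhd E v" and ?F = "edges_in E (nbhd E v)"
    have W: "?W \<subseteq> V" "finite ?W" using nbhd_subset[OF E, of v] V finite_subset[of ?W V] by auto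
    have "?W \<noteq> {}" using final(2)[OF v(1)] by auto
    moreover have "d \<le> card (nbhd ?F w)" if "w \<in> ?W" for w
      using final(3)[of v w] that nbhd_edges_in[OF that, of E] by (simp add: nbhd_def Int_commute)
    moreover have "is_minor (UGraph ?W ?F) (UGraph V E)"
      using W by (intro is_minor_subgraph) (auto simp: edges_in_def)
    ultimately show ?thesis using W v(2) edges_in_nsets2[OF E] by blast
  qed
qed

section \<open>Complete minors in graphs of large average degree\<close>

lemma twice_card_edges_le:
  assumes "finite S" "E \<subseteq> [V]\<^bsup>2\<^esup>"
  shows "2 * card (edges_in E S) \<le> card S * (card S - 1)"
proof -
  have "(\<Sum>v\<in>S. card (nbhd E v \<inter> S)) \<le> (\<Sum>v\<in>S. card S - 1)"
  proof (rule sum_mono)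
    fix v assume "v \<in> S"
    then have "card (S - {v}) = card S - 1" using assms(1) by simp
    moreover have "card (nbhd E v \<inter> S) \<le> card (S - {v})"
      using nbhd_subset[OF assms(2), of v] assms(1) by (intro card_mono) auto
    ultimately show "card (nbhd E v \<inter> S) \<le> card S - 1" by simp
  qed
  then show ?thesis using handshake_in[OF assms] by simp
qed

text \<open>A set \<open>B\<close> closed under adjacency in \<open>S - Y\<close> is a union of
  components, so this says that deleting at most \<mu> vertices leaves \<open>S\<close> connected.
  The form with closed sets instead of paths is the one that an edge count can contradict and that
  the layers of a breadth-first search can use directly.\<close>

definition no_separation :: "'a set set \<Rightarrow> 'a set \<Rightarrow> nat \<Rightarrow> bool" where
  "no_separation E S \<mu> \<longleftrightarrow> (\<forall>Y B. Y \<subseteq> S \<and> card Y \<le> \<mu> \<and> B \<subseteq> S - Y \<and> B \<noteq> {} \<and>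
     (\<forall>x\<in>B. nbhd E x \<inter> S \<subseteq> B \<union> Y) \<longrightarrow> B = S - Y)"

text \<open>Mader's argument: in a minimal set \<open>S\<close> spanning more than \<open>2\<mu>(|S| - \<mu>)\<close> edges, a separation
  of order at most \<open>\<mu>\<close> would make one of its two sides a smaller such set.\<close>

lemma highly_connected_subset:
  fixes \<mu> :: nat
  assumes V: "finite V" and E: "E \<subseteq> [V]\<^bsup>2\<^esup>" and ne: "V \<noteq> {}"
    and dens: "2 * \<mu> * card V \<le> card E" and \<mu>: "\<mu> \<ge> 1"
  obtains S where "S \<subseteq> V" "2 * \<mu> \<le> card S" "\<And>v. v \<in> S \<Longrightarrow> 2 * \<mu> < card (nbhd E v \<inter> S)"
    "no_separation E S \<mu>"
proof -
  \<comment> \<open>The inequality is written without subtraction. When \<open>S\<close> is divided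
    into two overlapping sides, the correction \<open>2 * \<mu> * \<mu>\<close> occurs twice: one
    copy pays for the at most \<mu> separating vertices that are counted in both sides, the other is
    the copy needed for \<open>S\<close> itself.\<close>
  define P where "P S \<longleftrightarrow> S \<subseteq> V \<and> 2 * \<mu> \<le> card S \<and>
    2 * \<mu> * card S < card (edges_in E S) + 2 * \<mu> * \<mu>" for S
  have EV: "edges_in E V = E" using E by (auto simp: edges_in_def nsets_def)
  have cV: "card V > 0" using V ne by (simp add: card_gt_0_iff)
  have "2 * (2 * \<mu> * card V) \<le> card V * (card V - 1)"
    by (rule order_trans[OF mult_le_mono2[OF dens] twice_card_edges_le[OF V E, unfolded EV]])
  then have "card V * (4 * \<mu>) \<le> card V * (card V - 1)" by (simp only: ac_simps)
  then have "4 * \<mu> \<le> card V - 1" using cV by (simp only: nat_mult_le_cancel_disj)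
  then have "P V" unfolding P_def using dens EV \<mu> by (auto intro: le_less_trans)
  then obtain S where S: "P S" and least: "\<And>S'. P S' \<Longrightarrow> card S \<le> card S'"
    using ex_has_least_nat[of P V card] by blast
  have fS: "finite S" using S V finite_subset unfolding P_def by blast
  have SV: "S \<subseteq> V" and S2: "2 * \<mu> \<le> card S"
    and Se: "2 * \<mu> * card S < card (edges_in E S) + 2 * \<mu> * \<mu>" using S unfolding P_def by auto
  have deg: "2 * \<mu> < card (nbhd E v \<inter> S)" if v: "v \<in> S" for v
  proof (rule ccontr)
    assume low: "\<not> ?thesis"
    \<comment> \<open>On \<open>2 * \<mu>\<close> vertices, \<open>P\<close> asks for more than
      \<open>2 * \<mu> * \<mu>\<close> edges, beyond the complete graph. So a vertex can be removed
      without falling below the required size.\<close>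
    have "card S \<noteq> 2 * \<mu>"
    proof
      assume c: "card S = 2 * \<mu>"
      have "2 * card (edges_in E S) \<le> 2 * \<mu> * (2 * \<mu> - 1)"
        using twice_card_edges_le[OF fS E] c by simp
      also have "\<dots> \<le> 2 * \<mu> * (2 * \<mu>)" by (intro mult_left_mono) auto
      finally have "2 * card (edges_in E S) \<le> 2 * \<mu> * (2 * \<mu>)" .
      then have "card (edges_in E S) \<le> 2 * \<mu> * \<mu>" by simp
      then show False using Se c by (simp add: algebra_simps)
    qed
    then have big: "2 * \<mu> < card S" using S2 by simp
    have c1: "card (S - {v}) = card S - 1" using v fS by simp
    have "card (edges_in E S) \<le> card (edges_in E (S - {v})) + 2 * \<mu>"
      using card_edges_in_remove[OF fS E v] low by simp
    moreover have "2 * \<mu> * card S = 2 * \<mu> * (card S - 1) + 2 * \<mu>"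
      using big by (cases "card S") auto
    ultimately have "2 * \<mu> * (card S - 1) < card (edges_in E (S - {v})) + 2 * \<mu> * \<mu>"
      using Se by linarith
    then have "P (S - {v})" unfolding P_def using c1 big SV by auto
    then show False using least[of "S - {v}"] c1 big by simp
  qed
  have sep: "B = S - Y" if Y: "Y \<subseteq> S" "card Y \<le> \<mu>" and B: "B \<subseteq> S - Y" "B \<noteq> {}"
    and closed: "\<And>x. x \<in> B \<Longrightarrow> nbhd E x \<inter> S \<subseteq> B \<union> Y" for Y B
  proof (rule ccontr)
    assume "B \<noteq> S - Y"
    then obtain z where z: "z \<in> S" "z \<notin> Y" "z \<notin> B" using B by blast
    obtain x where x: "x \<in> B" using B by blast
    \<comment> \<open>Each side contains all neighbours in \<open>S\<close> of one of its vertices,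
      so it is large enough for \<open>P\<close>; as a proper subset of the minimal \<open>S\<close>
      it must then violate the edge count.\<close>
    let ?A1 = "B \<union> Y" and ?A2 = "S - B"
    have fB: "finite B" "finite Y" using B Y fS by (auto intro: finite_subset)
    have "?A1 \<subset> S" using Y B z by blast
    then have l1: "card ?A1 < card S" using fS by (simp add: psubset_card_mono)
    have "?A2 \<subset> S" using x B by blast
    then have l2: "card ?A2 < card S" using fS by (simp add: psubset_card_mono)
    have "card (nbhd E x \<inter> S) \<le> card ?A1" using closed[OF x] fB by (intro card_mono) auto
    moreover have "2 * \<mu> < card (nbhd E x \<inter> S)" using deg x B by blast
    ultimately have g1: "2 * \<mu> \<le> card ?A1" by simp
    have "nbhd E z \<inter> S \<subseteq> ?A2"
    proof
      fix w assume w: "w \<in> nbhd E z \<inter> S"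
      have "w \<notin> B"
      proof
        assume "w \<in> B"
        moreover have "z \<in> nbhd E w \<inter> S" using w z by (simp add: nbhd_sym[of z])
        ultimately show False using closed z by blast
      qed
      then show "w \<in> ?A2" using w by simp
    qed
    then have "card (nbhd E z \<inter> S) \<le> card ?A2" using fS by (intro card_mono) auto
    then have g2: "2 * \<mu> \<le> card ?A2" using deg[OF z(1)] by simp
    have n1: "card (edges_in E ?A1) + 2 * \<mu> * \<mu> \<le> 2 * \<mu> * card ?A1"
    proof (rule ccontr)
      assume "\<not> ?thesis"
      then have "P ?A1" unfolding P_def using g1 SV \<open>?A1 \<subset> S\<close> by auto
      then show False using least l1 by fastforce
    qed
    have n2: "card (edges_in E ?A2) + 2 * \<mu> * \<mu> \<le> 2 * \<mu> * card ?A2"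
    proof (rule ccontr)
      assume "\<not> ?thesis"
      then have "P ?A2" unfolding P_def using g2 SV by auto
      then show False using least l2 by fastforce
    qed
    have "edges_in E S \<subseteq> edges_in E ?A1 \<union> edges_in E ?A2"
    proof
      fix e assume e: "e \<in> edges_in E S"
      then have "e \<in> [S]\<^bsup>2\<^esup>" using edges_in_nsets2[OF E] by blast
      then obtain u w where uw: "e = {u, w}" "u \<in> S" "w \<in> S" by (rule in_nsets2E)
      have eE: "e \<in> E" using e by (simp add: edges_in_def)
      show "e \<in> edges_in E ?A1 \<union> edges_in E ?A2"
      proof (cases "u \<in> B \<or> w \<in> B")
        case True
        have "w \<in> nbhd E u \<inter> S" "u \<in> nbhd E w \<inter> S" using uw eE by (auto simp: nbhd_def insert_commute)
        then have "u \<in> ?A1" "w \<in> ?A1" using closed[of u] closed[of w] True by blast+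
        then show ?thesis using uw eE by (simp add: edges_in_def)
      next
        case False
        then show ?thesis using uw eE by (simp add: edges_in_def)
      qed
    qed
    moreover have "finite (edges_in E ?A1)" "finite (edges_in E ?A2)"
      using finite_edges[OF V E] by (auto simp: edges_in_def)
    ultimately have "card (edges_in E S) \<le> card (edges_in E ?A1) + card (edges_in E ?A2)"
      by (meson card_Un_le card_mono finite_UnI order_trans)
    moreover have "card ?A1 = card B + card Y"
      using fB B by (intro card_Un_disjoint) auto
    moreover have "card ?A2 = card S - card B" using B fB by (intro card_Diff_subset) auto
    moreover have "card B \<le> card S" using B fS by (intro card_mono) auto
    ultimately have "card (edges_in E S) + 4 * \<mu> * \<mu> \<le> 2 * \<mu> * (card B + card Y) + 2 * \<mu> * (card S - card B)"
      using n1 n2 by simp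
    also have "\<dots> = 2 * \<mu> * (card S + card Y)"
      using \<open>card B \<le> card S\<close> by (simp add: distrib_left[symmetric])
    also have "\<dots> \<le> 2 * \<mu> * (card S + \<mu>)" using Y(2) by (intro mult_left_mono) auto
    finally show False using Se by (simp add: algebra_simps)
  qed
  then have "no_separation E S \<mu>" unfolding no_separation_def by blast
  then show thesis using that[OF SV S2 deg] by blast
qed

text \<open>Every third layer around \<open>x\<close> contains a whole neighbourhood, so there are fewer than \<open>3J\<close> layers.\<close>

lemma short_connection:
  fixes \<mu> J :: nat
  assumes fin: "finite S"
    and closed: "\<And>B. B \<subseteq> S \<Longrightarrow> B \<noteq> {} \<Longrightarrow> (\<And>x. x \<in> B \<Longrightarrow> nbhd E x \<inter> S \<subseteq> B) \<Longrightarrow> B = S"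
    and deg: "\<And>x. x \<in> S \<Longrightarrow> \<mu> \<le> card (nbhd E x \<inter> S)"
    and J: "card S < J * \<mu>" and xy: "x \<in> S" "y \<in> S"
  shows "\<exists>C\<subseteq>S. conn E C \<and> x \<in> C \<and> y \<in> C \<and> card C \<le> 3 * J + 1"
proof -
  define B where "B j = ((\<lambda>A. A \<union> (\<Union>a\<in>A. nbhd E a \<inter> S)) ^^ j) {x}" for j
  have B0: "B 0 = {x}" and BS: "B (Suc j) = B j \<union> (\<Union>a\<in>B j. nbhd E a \<inter> S)" for j
    by (auto simp: B_def)
  have sub: "B j \<subseteq> S" for j by (induction j) (use xy B0 BS in auto)
  have xB: "x \<in> B j" for j by (induction j) (use B0 BS in auto)
  have reach: "\<forall>z\<in>B j. \<exists>C\<subseteq>S. conn E C \<and> x \<in> C \<and> z \<in> C \<and> card C \<le> j + 1" for j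
  proof (induction j)
    case 0
    show ?case
    proof
      fix z assume "z \<in> B 0"
      then show "\<exists>C\<subseteq>S. conn E C \<and> x \<in> C \<and> z \<in> C \<and> card C \<le> 0 + 1"
        using B0 xy by (intro exI[of _ "{x}"]) (auto simp: conn_singleton)
    qed
  next
    case (Suc j)
    show ?case
    proof
      fix z assume z: "z \<in> B (Suc j)"
      show "\<exists>C\<subseteq>S. conn E C \<and> x \<in> C \<and> z \<in> C \<and> card C \<le> Suc j + 1"
      proof (cases "z \<in> B j")
        case True
        then obtain C where "C \<subseteq> S" "conn E C" "x \<in> C" "z \<in> C" "card C \<le> j + 1" using Suc by blast
        then show ?thesis by (intro exI[of _ C]) auto
      next
        case False
        then obtain a where a: "a \<in> B j" "z \<in> nbhd E a" "z \<in> S" using z BS by auto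
        then obtain C where C: "C \<subseteq> S" "conn E C" "x \<in> C" "a \<in> C" "card C \<le> j + 1" using Suc by blast
        have "conn E (C \<union> {z})"
          by (rule conn_Un[OF C(2) conn_singleton C(4), of z]) (use a in \<open>auto simp: nbhd_def\<close>)
        moreover have "card (C \<union> {z}) \<le> card C + 1"
          using card_Un_le[of C "{z}"] by simp
        ultimately show ?thesis using C a by (intro exI[of _ "C \<union> {z}"]) auto
      qed
    qed
  qed
  have grow: "\<exists>z. z \<in> B (Suc j) \<and> z \<notin> B j" if "B j \<noteq> S" for j
  proof (rule ccontr)
    assume "\<not> ?thesis"
    then have "B (Suc j) \<subseteq> B j" by blast
    then have "nbhd E a \<inter> S \<subseteq> B j" if "a \<in> B j" for a using BS[of j] that by blast
    then have "B j = S" using closed[OF sub, of j] xB by blast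
    then show False using that by simp
  qed
  have "B (3 * j) = S \<or> j * \<mu> \<le> card (B (3 * j))" for j
  proof (induction j)
    case (Suc j)
    show ?case
    proof (cases "B (3 * Suc j) = S")
      case False
      have e: "3 * Suc j = Suc (Suc (Suc (3 * j)))" by simp
      have ne1: "B (Suc (3 * j)) \<noteq> S" and ne0: "B (3 * j) \<noteq> S"
        using False sub[of "3 * Suc j"] unfolding e BS[of "Suc (Suc (3 * j))"] BS[of "Suc (3 * j)"] BS[of "3 * j"]
        by auto
      \<comment> \<open>\<open>z\<close> has distance exactly \<open>3 * j + 2\<close> from
        \<open>x\<close>, so its neighbourhood lies within distance \<open>3 * j + 3\<close> and
        misses the ball of radius \<open>3 * j\<close>: three layers gain at least \<mu>
        vertices.\<close>
      obtain z where z: "z \<in> B (Suc (Suc (3 * j)))" "z \<notin> B (Suc (3 * j))" using grow[OF ne1] by blast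
      have zS: "z \<in> S" using z(1) sub by blast
      have "nbhd E z \<inter> S \<subseteq> B (3 * Suc j)" unfolding e using z(1) BS[of "Suc (Suc (3 * j))"] by blast
      moreover have "B (3 * j) \<subseteq> B (3 * Suc j)" unfolding e BS by blast
      moreover have "(nbhd E z \<inter> S) \<inter> B (3 * j) = {}"
      proof (rule ccontr)
        assume "\<not> ?thesis"
        then obtain u where "u \<in> nbhd E z" "u \<in> B (3 * j)" by blast
        then have "z \<in> B (Suc (3 * j))" using BS[of "3 * j"] zS nbhd_sym[of u E z] by auto
        then show False using z by simp
      qed
      moreover have "finite (B (3 * Suc j))" "finite (B (3 * j))" using sub fin finite_subset by blast+
      ultimately have "card (nbhd E z \<inter> S) + card (B (3 * j)) \<le> card (B (3 * Suc j))"
        using fin by (subst card_Un_disjoint[symmetric]) (auto intro!: card_mono)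
      then show ?thesis using deg[OF zS] Suc.IH ne0 by simp
    qed simp
  qed simp
  moreover have "card (B (3 * J)) \<le> card S" using sub fin by (simp add: card_mono)
  ultimately have "B (3 * J) = S" using J by (meson leD le_trans)
  then show ?thesis using reach xy by blast
qed

text \<open>Each further vertex of \<open>A\<close> is joined to an earlier one by a connected set
  of at most \<open>3 * J + 1\<close> vertices. So a set chosen only for what it dominates becomes
  connected at the cost of a constant factor.\<close>

lemma connected_superset:
  fixes \<mu> J :: nat
  assumes fin: "finite S"
    and closed: "\<And>B. B \<subseteq> S \<Longrightarrow> B \<noteq> {} \<Longrightarrow> (\<And>x. x \<in> B \<Longrightarrow> nbhd E x \<inter> S \<subseteq> B) \<Longrightarrow> B = S"
    and deg: "\<And>x. x \<in> S \<Longrightarrow> \<mu> \<le> card (nbhd E x \<inter> S)"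
    and J: "card S < J * \<mu>" and A: "finite A" "A \<noteq> {}" "A \<subseteq> S"
  shows "\<exists>M\<subseteq>S. conn E M \<and> A \<subseteq> M \<and> card M \<le> card A * (3 * J + 1)"
  using A
proof (induction A rule: finite_ne_induct)
  case (singleton x)
  then show ?case by (intro exI[of _ "{x}"]) (auto simp: conn_singleton)
next
  case (insert x F)
  then obtain M where M: "M \<subseteq> S" "conn E M" "F \<subseteq> M" "card M \<le> card F * (3 * J + 1)" by blast
  obtain z where z: "z \<in> F" using insert by blast
  obtain C where C: "C \<subseteq> S" "conn E C" "x \<in> C" "z \<in> C" "card C \<le> 3 * J + 1"
    using short_connection[OF fin closed deg J, of x z] insert.prems z by blast
  have "conn E (M \<union> C)" by (rule conn_Un[OF M(2) C(2), of z z]) (use z M C in auto)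
  moreover have "card (M \<union> C) \<le> card (insert x F) * (3 * J + 1)"
    using card_Un_le[of M C] M C insert by simp
  ultimately show ?case using M C by (intro exI[of _ "M \<union> C"]) auto
qed

section \<open>Dominating tuples and the greedy choice of branch sets\<close>

lemma card_tuples_avoiding:
  fixes s :: nat
  assumes "finite S"
  shows "card {f \<in> {..<s} \<rightarrow>\<^sub>E S. \<forall>j<s. f j \<notin> Z} = card (S - Z) ^ s"
proof -
  have "f \<in> {..<s} \<rightarrow>\<^sub>E (S - Z) \<longleftrightarrow> f \<in> {..<s} \<rightarrow>\<^sub>E S \<and> (\<forall>j<s. f j \<notin> Z)" for f
    unfolding PiE_iff by (simp only: Ball_def lessThan_iff Diff_iff) (rule iffI; simp)
  then have "{f \<in> {..<s} \<rightarrow>\<^sub>E S. \<forall>j<s. f j \<notin> Z} = {..<s} \<rightarrow>\<^sub>E (S - Z)" by blast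
  then show ?thesis by (simp add: card_PiE)
qed

text \<open>A uniformly random tuple works with positive probability. By Markov's inequality at most
  half of all tuples leave more than \<open>b\<close> vertices of \<open>W\<close> undominated
  (\<open>B1\<close>), and by the union bound fewer than half lie entirely inside some
  \<open>Z i\<close> (\<open>B2\<close>). Entries may repeat, so they are independent and both
  counts are plain powers.\<close>

lemma exists_dominating_tuple:
  fixes s \<mu> :: nat and b :: real and W :: "'a set" and Z :: "'i \<Rightarrow> 'a set"
  assumes fin: "finite S" "finite W" "finite I"
    and deg: "\<And>w. w \<in> W \<Longrightarrow> \<mu> \<le> card (N w \<inter> S)"
    and Z: "\<And>i. i \<in> I \<Longrightarrow> Z i \<subseteq> S" "\<And>i. i \<in> I \<Longrightarrow> real (card (Z i)) \<le> b"
    and b: "b > 0" "2 * real (card W) * real (card S - \<mu>) ^ s \<le> b * real (card S) ^ s"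
    and I: "2 * real (card I) * b ^ s < real (card S) ^ s"
  shows "\<exists>f. (\<forall>j<s. f j \<in> S) \<and> real (card {w \<in> W. \<forall>j<s. f j \<notin> N w}) \<le> b \<and>
    (\<forall>i\<in>I. \<exists>j<s. f j \<notin> Z i)"
proof -
  let ?\<Omega> = "{..<s} \<rightarrow>\<^sub>E S"
  define nd where "nd f = card {w \<in> W. \<forall>j<s. f j \<notin> N w}" for f
  define B1 where "B1 = {f \<in> ?\<Omega>. real (nd f) > b}"
  define B2 where "B2 = (\<Union>i\<in>I. {f \<in> ?\<Omega>. \<forall>j<s. f j \<notin> S - Z i})"
  have f\<Omega>: "finite ?\<Omega>" using fin by (simp add: finite_PiE)
  have c\<Omega>: "card ?\<Omega> = card S ^ s" by (simp add: card_PiE)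
  have "(\<Sum>f\<in>?\<Omega>. nd f) = (\<Sum>f\<in>?\<Omega>. \<Sum>w\<in>W. if \<forall>j<s. f j \<notin> N w then 1 else 0)"
    unfolding nd_def using fin by (simp add: sum.If_cases Int_def)
  also have "\<dots> = (\<Sum>w\<in>W. \<Sum>f\<in>?\<Omega>. if \<forall>j<s. f j \<notin> N w then 1 else 0)" by (rule sum.swap)
  also have "\<dots> = (\<Sum>w\<in>W. card (S - N w) ^ s)"
    using f\<Omega> card_tuples_avoiding[OF fin(1)] by (simp add: sum.If_cases Int_def)
  also have "\<dots> \<le> (\<Sum>w\<in>W. (card S - \<mu>) ^ s)"
  proof (intro sum_mono power_mono)
    fix w assume "w \<in> W"
    have "card (S - N w) = card S - card (N w \<inter> S)"
      using fin by (simp add: card_Diff_subset_Int Int_commute)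
    then show "card (S - N w) \<le> card S - \<mu>" using deg[OF \<open>w \<in> W\<close>] by simp
  qed simp
  finally have tot: "(\<Sum>f\<in>?\<Omega>. nd f) \<le> card W * (card S - \<mu>) ^ s" by simp
  have "2 * (b * real (card B1)) = (\<Sum>f\<in>B1. 2 * b)" by simp
  also have "\<dots> \<le> (\<Sum>f\<in>B1. 2 * real (nd f))" by (intro sum_mono) (auto simp: B1_def)
  also have "\<dots> \<le> (\<Sum>f\<in>?\<Omega>. 2 * real (nd f))"
    using f\<Omega> by (intro sum_mono2) (auto simp: B1_def)
  also have "\<dots> = 2 * real (\<Sum>f\<in>?\<Omega>. nd f)" by (simp add: sum_distrib_left)
  also have "\<dots> \<le> 2 * real (card W * (card S - \<mu>) ^ s)" using tot by (simp only: of_nat_le_iff mult_le_cancel_left_pos)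
  also have "\<dots> \<le> b * real (card S) ^ s" using b(2) by simp
  finally have c1: "2 * real (card B1) \<le> real (card S) ^ s" using b(1) by simp
  have "card B2 \<le> (\<Sum>i\<in>I. card {f \<in> ?\<Omega>. \<forall>j<s. f j \<notin> S - Z i})"
    unfolding B2_def by (rule card_UN_le[OF fin(3)])
  then have "real (card B2) \<le> (\<Sum>i\<in>I. real (card {f \<in> ?\<Omega>. \<forall>j<s. f j \<notin> S - Z i}))"
    by (simp only: of_nat_sum[symmetric] of_nat_le_iff)
  also have "\<dots> \<le> (\<Sum>i\<in>I. b ^ s)"
  proof (intro sum_mono)
    fix i assume i: "i \<in> I"
    have "S - (S - Z i) = Z i" using Z(1)[OF i] by blast
    then show "real (card {f \<in> ?\<Omega>. \<forall>j<s. f j \<notin> S - Z i}) \<le> b ^ s"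
      using card_tuples_avoiding[OF fin(1), of s "S - Z i"] Z(2)[OF i] by (simp add: power_mono)
  qed
  finally have "2 * real (card B2) < real (card S) ^ s" using I by simp
  then have "real (card B1 + card B2) < real (card ?\<Omega>)" using c1 c\<Omega> by simp
  then have "card B1 + card B2 < card ?\<Omega>" by (simp only: of_nat_less_iff)
  then have "card (B1 \<union> B2) < card ?\<Omega>" using card_Un_le[of B1 B2] by simp
  moreover have "B1 \<union> B2 \<subseteq> ?\<Omega>" by (auto simp: B1_def B2_def)
  ultimately obtain f where f: "f \<in> ?\<Omega>" "f \<notin> B1" "f \<notin> B2" by (metis UnCI less_irrefl subsetI subset_antisym)
  have fS: "\<forall>j<s. f j \<in> S" using f(1) by auto
  moreover have "real (card {w \<in> W. \<forall>j<s. f j \<notin> N w}) \<le> b" using f(1,2) by (auto simp: B1_def nd_def)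
  moreover have "\<exists>j<s. f j \<notin> Z i" if "i \<in> I" for i
    using f(1,3) that fS unfolding B2_def by blast
  ultimately show ?thesis by blast
qed

text \<open>Branch sets are chosen greedily in what the earlier ones leave over. The induction keeps
  that each \<open>M i\<close> is adjacent to all but few vertices: to meet every
  \<open>M i\<close>, the next tuple only has to escape the small sets of vertices not adjacent to
  them, and it fails for one \<open>i\<close> with probability at most
  \<open>(4 * (8 / 9) ^ s) ^ s\<close>. The exponent is quadratic in \<open>s\<close>, which is why
  \<open>s\<close> of order \<surd>log d suffices where plain domination would need log d.\<close>

lemma complete_family_in_connected_graph:
  fixes \<mu> s r :: nat
  assumes fin: "finite S" and \<mu>: "\<mu> \<ge> 1" and s: "s \<ge> 1"
    and card: "2 * \<mu> \<le> card S" "card S \<le> 9 * \<mu>"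
    and deg: "\<And>v. v \<in> S \<Longrightarrow> 2 * \<mu> < card (nbhd E v \<inter> S)"
    and sep: "no_separation E S \<mu>"
    and num: "2 * real \<mu> * (4 * (8 / 9) ^ s) ^ s < 1"
    and r: "64 * s * r \<le> \<mu>"
  shows "\<exists>M. (\<forall>i<r. M i \<subseteq> S \<and> conn E (M i) \<and> card (M i) \<le> 31 * s \<and>
      real (card {w \<in> S. nbhd E w \<inter> M i = {}}) \<le> 2 * real (card S) * (8 / 9) ^ s) \<and>
    (\<forall>i<r. \<forall>j<r. i \<noteq> j \<longrightarrow> M i \<inter> M j = {} \<and> (\<exists>u\<in>M i. \<exists>v\<in>M j. {u, v} \<in> E))"
  using r
proof (induction r)
  case (Suc r)
  define b where "b = 2 * real (card S) * (8 / 9) ^ s"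
  have "64 * s * r \<le> \<mu>" using Suc.prems by simp
  from Suc.IH[OF this] obtain M where IH: "\<forall>i<r. M i \<subseteq> S \<and> conn E (M i) \<and> card (M i) \<le> 31 * s \<and>
      real (card {w \<in> S. nbhd E w \<inter> M i = {}}) \<le> b"
    "\<forall>i<r. \<forall>j<r. i \<noteq> j \<longrightarrow> M i \<inter> M j = {} \<and> (\<exists>u\<in>M i. \<exists>v\<in>M j. {u, v} \<in> E)"
    unfolding b_def by (elim exE conjE)
  have M: "\<And>i. i < r \<Longrightarrow> M i \<subseteq> S" "\<And>i. i < r \<Longrightarrow> conn E (M i)"
     "\<And>i. i < r \<Longrightarrow> card (M i) \<le> 31 * s"
     "\<And>i. i < r \<Longrightarrow> real (card {w \<in> S. nbhd E w \<inter> M i = {}}) \<le> b"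
     "\<And>i j. i < r \<Longrightarrow> j < r \<Longrightarrow> i \<noteq> j \<Longrightarrow> M i \<inter> M j = {}"
     "\<And>i j. i < r \<Longrightarrow> j < r \<Longrightarrow> i \<noteq> j \<Longrightarrow> \<exists>u\<in>M i. \<exists>v\<in>M j. {u, v} \<in> E"
    using IH by simp_all
  define Y where "Y = (\<Union>i<r. M i)"
  define S' where "S' = S - Y"
  have YS: "Y \<subseteq> S" using M(1) by (auto simp: Y_def)
  have fY: "finite Y" "finite S'" using YS fin finite_subset by (auto simp: S'_def)
  have "card Y \<le> (\<Sum>i<r. card (M i))" unfolding Y_def by (rule card_UN_le) simp
  also have "\<dots> \<le> (\<Sum>i<r. 31 * s)" using M(3) by (intro sum_mono) auto
  \<comment> \<open>At most \<open>31 * s\<close> vertices per branch set and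
    \<open>64 * s * r \<le> \<mu>\<close> keep \<open>Y\<close> below half of \<mu>. So degrees into
    \<open>S'\<close> remain at least \<mu>, and \<open>Y\<close> is too small to separate
    \<open>S\<close>.\<close>
  finally have cY: "2 * card Y \<le> \<mu>" using Suc.prems by (simp add: algebra_simps)
  have cS': "card S' = card S - card Y" unfolding S'_def using YS fY by (intro card_Diff_subset) auto
  have cS'2: "card S \<le> 2 * card S'" "card S' \<le> 9 * \<mu>" "0 < card S'" using cS' cY card \<mu> by linarith+
  have deg': "\<mu> \<le> card (nbhd E x \<inter> S')" if "x \<in> S" for x
  proof -
    have "nbhd E x \<inter> S \<subseteq> (nbhd E x \<inter> S') \<union> Y" by (auto simp: S'_def)
    then have "card (nbhd E x \<inter> S) \<le> card ((nbhd E x \<inter> S') \<union> Y)" using fY by (intro card_mono) auto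
    also have "\<dots> \<le> card (nbhd E x \<inter> S') + card Y" by (rule card_Un_le)
    finally show ?thesis using deg[OF that] cY by linarith
  qed
  have closed: "B = S'" if B: "B \<subseteq> S'" "B \<noteq> {}" and cl: "\<And>x. x \<in> B \<Longrightarrow> nbhd E x \<inter> S' \<subseteq> B" for B
  proof -
    have "nbhd E x \<inter> S \<subseteq> B \<union> Y" if "x \<in> B" for x using cl[OF that] by (auto simp: S'_def)
    moreover have "card Y \<le> \<mu>" using cY by simp
    ultimately show ?thesis using sep YS B unfolding no_separation_def S'_def by simp
  qed
  have b0: "b > 0" unfolding b_def using card \<mu> by simp
  define Z where "Z i = {w \<in> S'. nbhd E w \<inter> M i = {}}" for i
  have Zb: "real (card (Z i)) \<le> b" if "i < r" for i
  proof -
    have "Z i \<subseteq> {w \<in> S. nbhd E w \<inter> M i = {}}" by (auto simp: Z_def S'_def)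
    then have "card (Z i) \<le> card {w \<in> S. nbhd E w \<inter> M i = {}}" using fin by (intro card_mono) auto
    then show ?thesis using M(4)[OF that] by linarith
  qed
  \<comment> \<open>Since \<open>S'\<close> has at most \<open>9 * \<mu>\<close> vertices, a vertex
    with \<mu> neighbours in it is missed by a random entry with probability at most 8/9.\<close>
  have "real (card S' - \<mu>) \<le> 8 / 9 * real (card S')"
    using cS'2(2) by (cases "card S' \<ge> \<mu>") (auto simp: of_nat_diff)
  then have "real (card S' - \<mu>) ^ s \<le> (8 / 9 * real (card S')) ^ s" by (intro power_mono) auto
  then have c1: "2 * real (card S) * real (card S' - \<mu>) ^ s \<le> b * real (card S') ^ s"
    unfolding b_def power_mult_distrib by (simp add: mult.assoc mult_left_mono)
  have "b \<le> (4 * (8 / 9) ^ s) * real (card S')"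
    using cS'2(1) unfolding b_def by (simp add: mult.assoc[symmetric] mult.commute[of "(8/9)^s"])
  then have "b ^ s \<le> ((4 * (8 / 9) ^ s) * real (card S')) ^ s" using b0 by (intro power_mono) auto
  then have bs: "b ^ s \<le> (4 * (8 / 9) ^ s) ^ s * real (card S') ^ s" by (simp add: power_mult_distrib)
  have rm: "r \<le> \<mu>"
  proof -
    have "1 * r \<le> 64 * s * Suc r" using s by (intro mult_le_mono) auto
    then show ?thesis using Suc.prems by linarith
  qed
  have "2 * real r * b ^ s \<le> 2 * real \<mu> * ((4 * (8 / 9) ^ s) ^ s * real (card S') ^ s)"
    using rm bs b0 by (intro mult_mono) auto
  also have "\<dots> = (2 * real \<mu> * (4 * (8 / 9) ^ s) ^ s) * real (card S') ^ s" by simp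
  also have "\<dots> < 1 * real (card S') ^ s"
    using num cS'2(3) by (intro mult_strict_right_mono) auto
  finally have c2: "2 * real (card {..<r}) * b ^ s < real (card S') ^ s" by simp
  have "\<exists>f. (\<forall>j<s. f j \<in> S') \<and> real (card {w \<in> S. \<forall>j<s. f j \<notin> nbhd E w}) \<le> b \<and>
    (\<forall>i\<in>{..<r}. \<exists>j<s. f j \<notin> Z i)"
    by (rule exists_dominating_tuple[OF fY(2) fin finite_lessThan deg' _ _ b0 c1 c2])
       (use Zb in \<open>auto simp: Z_def\<close>)
  then obtain f where f': "(\<forall>j<s. f j \<in> S') \<and> real (card {w \<in> S. \<forall>j<s. f j \<notin> nbhd E w}) \<le> b \<and>
    (\<forall>i\<in>{..<r}. \<exists>j<s. f j \<notin> Z i)" by (elim exE)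
  then have f: "\<And>j. j < s \<Longrightarrow> f j \<in> S'" "real (card {w \<in> S. \<forall>j<s. f j \<notin> nbhd E w}) \<le> b"
    "\<And>i. i < r \<Longrightarrow> \<exists>j<s. f j \<notin> Z i" by simp_all
  have A: "finite (f ` {..<s})" "f ` {..<s} \<noteq> {}" "f ` {..<s} \<subseteq> S'" using f(1) s by (auto simp: lessThan_empty_iff)
  have deg'': "\<mu> \<le> card (nbhd E x \<inter> S')" if "x \<in> S'" for x using deg' that by (simp add: S'_def)
  \<comment> \<open>This permits \<open>J = 10\<close> for the connecting sets, whence the factor
    \<open>31 = 3 * 10 + 1\<close>.\<close>
  have "card S' < 10 * \<mu>" using cS'2(2) \<mu> by linarith
  then obtain C where C: "C \<subseteq> S'" "conn E C" "f ` {..<s} \<subseteq> C" "card C \<le> card (f ` {..<s}) * (3 * 10 + 1)"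
    using connected_superset[OF fY(2) closed deg'' _ A, of 10] by blast
  have "card (f ` {..<s}) \<le> s" using card_image_le[of "{..<s}" f] by simp
  then have Cc: "card C \<le> 31 * s" using C(4) by simp
  have "{w \<in> S. nbhd E w \<inter> C = {}} \<subseteq> {w \<in> S. \<forall>j<s. f j \<notin> nbhd E w}" using C(3) by auto
  then have "card {w \<in> S. nbhd E w \<inter> C = {}} \<le> card {w \<in> S. \<forall>j<s. f j \<notin> nbhd E w}"
    using fin by (intro card_mono) auto
  then have Cd: "real (card {w \<in> S. nbhd E w \<inter> C = {}}) \<le> b" using f(2) by linarith
  have Cdis: "M i \<inter> C = {}" if "i < r" for i using C(1) that by (auto simp: S'_def Y_def)
  have Cadj: "\<exists>u\<in>M i. \<exists>v\<in>C. {u, v} \<in> E" if i: "i < r" for i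
  proof -
    obtain j where j: "j < s" "f j \<notin> Z i" using f(3)[OF i] by blast
    then obtain u where "u \<in> nbhd E (f j)" "u \<in> M i" using f(1)[OF j(1)] by (auto simp: Z_def)
    moreover have "f j \<in> C" using C(3) j by auto
    ultimately show ?thesis by (auto simp: nbhd_def insert_commute)
  qed
  define M' where "M' = M(r := C)"
  have M'i: "M' i = M i" if "i < r" for i using that by (simp add: M'_def)
  have M'r: "M' r = C" by (simp add: M'_def)
  show ?case
  proof (intro exI[of _ M'] conjI allI impI)
    fix i assume "i < Suc r"
    then consider "i < r" | "i = r" by linarith
    note i = this
    show "M' i \<subseteq> S" using i by cases (use M(1) M'i M'r C(1) in \<open>auto simp: S'_def\<close>)
    show "conn E (M' i)" using i by cases (use M(2) M'i M'r C(2) in auto)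
    show "card (M' i) \<le> 31 * s" using i by cases (use M(3) M'i M'r Cc in auto)
    show "real (card {w \<in> S. nbhd E w \<inter> M' i = {}}) \<le> 2 * real (card S) * (8 / 9) ^ s"
      using i by cases (use M(4) M'i M'r Cd in \<open>auto simp: b_def\<close>)
  next
    fix i j assume "i < Suc r" "j < Suc r" "i \<noteq> j"
    then consider "i < r" "j < r" "i \<noteq> j" | "i = r" "j < r" | "i < r" "j = r" by linarith
    note ij = this
    show "M' i \<inter> M' j = {}" using ij
    proof cases
      case 1 then show ?thesis using M(5)[OF 1] M'i by simp
    next
      case 2 then show ?thesis using Cdis[of j] M'i M'r by auto
    next
      case 3 then show ?thesis using Cdis[of i] M'i M'r by auto
    qed
    show "\<exists>u\<in>M' i. \<exists>v\<in>M' j. {u, v} \<in> E" using ij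
    proof cases
      case 1 then show ?thesis using M(6)[OF 1] M'i by simp
    next
      case 2
      obtain u v where "u \<in> M j" "v \<in> C" "{u, v} \<in> E" using Cadj[OF 2(2)] by blast
      then have "{v, u} \<in> E" "v \<in> M' i" "u \<in> M' j" using 2 M'i M'r by (auto simp: insert_commute)
      then show ?thesis by blast
    next
      case 3
      then show ?thesis using Cadj M'i M'r by simp
    qed
  qed
qed simp

lemma complete_minor_of_dense_graph:
  fixes d s r :: nat
  assumes W: "finite W" "W \<noteq> {}" and F: "F \<subseteq> [W]\<^bsup>2\<^esup>" and card: "card W \<le> 2 * d"
    and deg: "\<And>w. w \<in> W \<Longrightarrow> d \<le> card (nbhd F w)" and d: "d \<ge> 24" and s: "s \<ge> 1"
    and num: "2 * real (d div 4) * (4 * (8 / 9) ^ s) ^ s < 1"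
    and r: "64 * s * r \<le> d div 4"
  shows "is_minor (complete_graph r) (UGraph W F)"
proof -
  define \<mu> where "\<mu> = d div 4"
  \<comment> \<open>24 is the threshold from which \<open>2 * d \<le> 9 * (d div 4)\<close> always
    holds. The factor 9 is the one behind the ratio 8/9.\<close>
  have \<mu>: "\<mu> \<ge> 1" "4 * \<mu> \<le> d" "2 * d \<le> 9 * \<mu>" using d by (auto simp: \<mu>_def)
  have "(\<Sum>w\<in>W. d) \<le> (\<Sum>w\<in>W. card (nbhd F w))" using deg by (intro sum_mono)
  then have "d * card W \<le> 2 * card F" using handshake[OF W(1) F] by (simp add: mult.commute)
  moreover have "4 * \<mu> * card W \<le> d * card W" using \<mu> by (intro mult_right_mono) auto
  ultimately have "2 * \<mu> * card W \<le> card F" by linarith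
  then obtain S where S: "S \<subseteq> W" "2 * \<mu> \<le> card S" "\<And>v. v \<in> S \<Longrightarrow> 2 * \<mu> < card (nbhd F v \<inter> S)"
    "no_separation F S \<mu>"
    using highly_connected_subset[OF W(1) F W(2) _ \<mu>(1)] by metis
  have fS: "finite S" using S(1) W(1) finite_subset by blast
  have "card S \<le> 9 * \<mu>" using card_mono[OF W(1) S(1)] card \<mu>(3) by linarith
  then obtain M where M: "\<forall>i<r. M i \<subseteq> S \<and> conn F (M i)"
    "\<forall>i<r. \<forall>j<r. i \<noteq> j \<longrightarrow> M i \<inter> M j = {} \<and> (\<exists>u\<in>M i. \<exists>v\<in>M j. {u, v} \<in> F)"
    using complete_family_in_connected_graph[OF fS \<mu>(1) s S(2) _ S(3,4) _ r[folded \<mu>_def]] num[folded \<mu>_def]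
    by blast
  show ?thesis unfolding is_minor_iff complete_graph_def ugraph.sel
  proof (intro exI[of _ M] conjI ballI impI)
    fix x y assume xy: "x \<in> {..<r}" "y \<in> {..<r}" "{x, y} \<in> [{..<r}]\<^bsup>2\<^esup>"
    then have "x \<noteq> y" by (simp add: doubleton_in_nsets2_iff)
    then show "\<exists>u\<in>M x. \<exists>v\<in>M y. {u, v} \<in> F" using M(2) xy by simp
  next
    fix x assume "x \<in> {..<r}"
    then show "conn F (M x)" "M x \<subseteq> W" using M(1) S(1) by (simp_all, blast)
  qed (use M in auto)
qed

theorem complete_minor_of_average_degree:
  "\<exists>c>0. \<forall>\<^sub>F d :: nat in sequentially. \<forall>(V :: 'a set) E.
     finite V \<and> V \<noteq> {} \<and> E \<subseteq> [V]\<^bsup>2\<^esup> \<and> d * card V \<le> card E \<longrightarrow>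
     (\<exists>t. c * real d / sqrt (ln (real d)) \<le> real t \<and> is_minor (complete_graph t) (UGraph V E))"
proof -
  \<comment> \<open>The failure probability for one earlier set will be at most exp (- s * s / 18).
    The factor 5 gives s * s \<ge> 25 ln d, which makes this at most 1 / d and so survives a union
    over \<open>d div 4\<close> sets.\<close>
  define s where "s d = nat \<lceil>5 * sqrt (ln (real d))\<rceil>" for d :: nat
  define r where "r d = (d div 4) div (64 * s d)" for d :: nat
  have lnd: "64 \<le> ln (real d)" if "nat \<lceil>exp 64 :: real\<rceil> \<le> d" for d :: nat
  proof -
    have "exp 64 \<le> real d" using that by linarith
    then show ?thesis by (metis exp_gt_zero ln_exp ln_le_cancel_iff order_less_le_trans)
  qed
  have sb: "5 * sqrt (ln (real d)) \<le> real (s d)" "real (s d) \<le> 6 * sqrt (ln (real d))" "s d \<ge> 36"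
    if "64 \<le> ln (real d)" for d
  proof -
    have "8 \<le> sqrt (ln (real d))" using that by (intro real_le_rsqrt) auto
    then show "5 * sqrt (ln (real d)) \<le> real (s d)" "real (s d) \<le> 6 * sqrt (ln (real d))" "s d \<ge> 36"
      unfolding s_def by linarith+
  qed
  have num: "\<forall>\<^sub>F d :: nat in sequentially. 2 * real (d div 4) * (4 * (8 / 9) ^ s d) ^ s d < 1"
    using eventually_ge_at_top[of "nat \<lceil>exp 64 :: real\<rceil>"] eventually_ge_at_top[of 1]
  proof eventually_elim
    case (elim d)
    note l = lnd[OF elim(1)]
    note sd = sb[OF l]
    \<comment> \<open>(8/9)^s is at most exp (- s / 9); half of this exponent is spent on absorbing
      the factor 4, which needs only \<open>s d \<ge> 36\<close>.\<close>
    have "(4 :: real) = 2 * 2" by simp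
    also have "\<dots> \<le> exp 1 * exp 1" using exp_ge_add_one_self[of 1] by (intro mult_mono) auto
    also have "\<dots> = exp 2" by (simp add: mult_exp_exp)
    also have "\<dots> \<le> exp (real (s d) / 18)" using sd(3) by simp
    finally have "4 \<le> exp (real (s d) / 18)" .
    moreover have "(8 / 9 :: real) ^ s d \<le> exp (- 1 / 9) ^ s d"
      using exp_ge_add_one_self[of "- 1 / 9"] by (intro power_mono) auto
    moreover have "exp (- 1 / 9) ^ s d = exp (- real (s d) / 9)" by (simp add: exp_of_nat_mult[symmetric])
    ultimately have "4 * (8 / 9) ^ s d \<le> exp (real (s d) / 18) * exp (- real (s d) / 9)"
      by (intro mult_mono) auto
    also have "\<dots> = exp (- real (s d) / 18)" by (simp add: mult_exp_exp)
    finally have "(4 * (8 / 9) ^ s d) ^ s d \<le> exp (- real (s d) / 18) ^ s d" by (intro power_mono) auto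
    also have "\<dots> = exp (- (real (s d) * real (s d)) / 18)" by (simp add: exp_of_nat_mult[symmetric])
    also have "\<dots> \<le> exp (- ln (real d))"
    proof -
      have "(5 * sqrt (ln (real d))) * (5 * sqrt (ln (real d))) \<le> real (s d) * real (s d)"
        using sd(1) l by (intro mult_mono) auto
      then have "25 * ln (real d) \<le> real (s d) * real (s d)" using l by simp
      then show ?thesis using l by simp
    qed
    also have "\<dots> = 1 / real d" using elim(2) by (simp add: exp_minus field_simps)
    finally have "2 * real (d div 4) * (4 * (8 / 9) ^ s d) ^ s d \<le> 2 * (real d / 4) * (1 / real d)"
      by (intro mult_mono) auto
    also have "\<dots> < 1" using elim(2) by simp
    finally show ?case .
  qed
  have rb: "\<forall>\<^sub>F d :: nat in sequentially. real d / sqrt (ln (real d)) / 10000 \<le> real (r d)"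
    using eventually_ge_at_top[of "nat \<lceil>exp 64 :: real\<rceil>"] eventually_ge_at_top[of "10 ^ 8"]
  proof eventually_elim
    case (elim d)
    note l = lnd[OF elim(1)]
    note sd = sb[OF l]
    have d8: "real d \<ge> 10 ^ 8" using elim(2) by (metis of_nat_le_iff of_nat_numeral of_nat_power)
    \<comment> \<open>3072 is 8 * 384: \<open>d div 4\<close> is at least d / 8, and 64 * s is at
      most 384 * q with q = \<surd>ln d. The remaining slack up to 10000 absorbs the rounding of the
      second division.\<close>
    have lin: "x / 10000 \<le> y" if "x / 3072 \<le> z" "z - 1 \<le> y" "10000 \<le> x" for x y z :: real
      using that by linarith
    define q where "q = sqrt (ln (real d))"
    have q0: "q > 0" using l by (simp add: q_def)
    have "ln (real d) \<le> real d" using d8 by (intro order_trans[OF ln_le_minus_one]) auto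
    then have "q \<le> sqrt (real d)" unfolding q_def by simp
    moreover have "sqrt (real d) \<ge> 10000" using d8 by (intro real_le_rsqrt) auto
    ultimately have "q * 10000 \<le> sqrt (real d) * sqrt (real d)" using q0 by (intro mult_mono) auto
    then have dq: "10000 \<le> real d / q" using q0 d8 by (simp add: field_simps)
    have s0: "0 < 64 * real (s d)" using sd(3) by simp
    have div: "real (a div b) \<ge> real a / real b - 1" if "b > 0" for a b :: nat
      using floor_correct[of "real a / real b"] by (simp add: floor_divide_of_nat_eq)
    have "real d / 8 \<le> real (d div 4)" using div[of 4 d] d8 by simp
    then have "real d / 8 / (384 * q) \<le> real (d div 4) / (64 * real (s d))"
      using sd(2) s0 q0 by (intro frac_le) (auto simp: q_def)
    moreover have "real (d div 4) / (64 * real (s d)) - 1 \<le> real (r d)"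
      using div[of "64 * s d" "d div 4"] sd(3) by (simp add: r_def)
    moreover have "real d / 8 / (384 * q) = (real d / q) / 3072" by simp
    ultimately have "real d / q / 10000 \<le> real (r d)" using dq by (intro lin) auto
    then show ?case by (simp add: q_def)
  qed
  have s1: "\<forall>\<^sub>F d :: nat in sequentially. s d \<ge> 1"
    using eventually_ge_at_top[of "nat \<lceil>exp 64 :: real\<rceil>"]
  proof eventually_elim
    case (elim d)
    show ?case using sb(3)[OF lnd[OF elim]] by linarith
  qed
  have "\<forall>\<^sub>F d :: nat in sequentially. \<forall>(V :: 'a set) E.
     finite V \<and> V \<noteq> {} \<and> E \<subseteq> [V]\<^bsup>2\<^esup> \<and> d * card V \<le> card E \<longrightarrow>
     (\<exists>t. 1 / 10000 * real d / sqrt (ln (real d)) \<le> real t \<and> is_minor (complete_graph t) (UGraph V E))"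
    using num rb s1 eventually_ge_at_top[of 24]
  proof eventually_elim
    case (elim d)
    show ?case
    proof (intro allI impI)
      fix V :: "'a set" and E
      assume *: "finite V \<and> V \<noteq> {} \<and> E \<subseteq> [V]\<^bsup>2\<^esup> \<and> d * card V \<le> card E"
      then have "\<exists>(W :: 'a set) F. finite W \<and> W \<noteq> {} \<and> F \<subseteq> [W]\<^bsup>2\<^esup> \<and> card W \<le> 2 * d \<and>
        (\<forall>w\<in>W. d \<le> card (nbhd F w)) \<and> is_minor (UGraph W F) (UGraph V E)"
        using elim(4) by (intro dense_minor_of_small_order) auto
      then obtain W :: "'a set" and F where W': "finite W \<and> W \<noteq> {} \<and> F \<subseteq> [W]\<^bsup>2\<^esup> \<and> card W \<le> 2 * d \<and>
        (\<forall>w\<in>W. d \<le> card (nbhd F w)) \<and> is_minor (UGraph W F) (UGraph V E)"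
        by (elim exE)
      then have W: "finite W" "W \<noteq> {}" "F \<subseteq> [W]\<^bsup>2\<^esup>" "card W \<le> 2 * d"
        "\<And>w. w \<in> W \<Longrightarrow> d \<le> card (nbhd F w)" "is_minor (UGraph W F) (UGraph V E)"
        by simp_all
      have "64 * s d * r d \<le> d div 4" unfolding r_def by simp
      then have "is_minor (complete_graph (r d)) (UGraph W F)"
        using complete_minor_of_dense_graph[OF W(1-5) elim(4,3,1)] by blast
      then have "is_minor (complete_graph (r d)) (UGraph V E)" using W(6) is_minor_trans by blast
      then show "\<exists>t. 1 / 10000 * real d / sqrt (ln (real d)) \<le> real t \<and> is_minor (complete_graph t) (UGraph V E)"
        using elim(2) by (intro exI[of _ "r d"]) simp
    qed
  qed
  then show ?thesis by (intro exI[of _ "1 / 10000"]) simp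
qed

section \<open>Random subsets\<close>

definition random_set :: "real \<Rightarrow> 'e set \<Rightarrow> 'e set pmf" where
  "random_set p E = map_pmf (\<lambda>kept. {e \<in> E. kept e}) (Pi_pmf E False (\<lambda>_. bernoulli_pmf p))"

text \<open>Taken as a functional of \<open>f\<close>, the expectation obeys a recursion that
  reveals one edge at a time (\<open>expect_insert\<close>). Independence of disjoint edge sets, the
  two-round exposure and the analysis of the exploration then become inductions over finite edge
  sets; probabilities enter as expectations of \<open>of_bool\<close>.\<close>

definition expect :: "real \<Rightarrow> 'e set \<Rightarrow> ('e set \<Rightarrow> real) \<Rightarrow> real" where
  "expect p E f = measure_pmf.expectation (random_set p E) f"

lemma random_set_insert:
  assumes "finite E" "e \<notin> E"
  shows "random_set p (insert e E) =
    bind_pmf (bernoulli_pmf p) (\<lambda>b. map_pmf (\<lambda>F. if b then insert e F else F) (random_set p E))"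
proof -
  have "random_set p (insert e E) = bind_pmf (bernoulli_pmf p)
      (\<lambda>b. map_pmf (\<lambda>k. {x \<in> insert e E. (k(e := b)) x}) (Pi_pmf E False (\<lambda>_. bernoulli_pmf p)))"
    unfolding random_set_def Pi_pmf_insert'[OF assms]
    by (simp add: map_bind_pmf map_pmf_def[symmetric] map_pmf_comp o_def)
  also have "(\<lambda>b k. {x \<in> insert e E. (k(e := b)) x}) = (\<lambda>b k. if b then insert e {x \<in> E. k x} else {x \<in> E. k x})"
    using assms(2) by (intro ext) auto
  finally show ?thesis unfolding random_set_def by (simp add: map_pmf_comp)
qed

lemma finite_set_pmf_random_set: "finite E \<Longrightarrow> finite (set_pmf (random_set p E))"
  by (rule finite_subset[of _ "Pow E"]) (auto simp: random_set_def)

lemma expect_empty [simp]: "expect p {} f = f {}"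
  by (simp add: expect_def random_set_def)

lemma expect_insert:
  assumes "finite E" "e \<notin> E" "0 \<le> p" "p \<le> 1"
  shows "expect p (insert e E) f = p * expect p E (\<lambda>F. f (insert e F)) + (1 - p) * expect p E f"
  unfolding expect_def random_set_insert[OF assms(1,2)]
  using assms finite_set_pmf_random_set[OF assms(1)]
  by (subst pmf_expectation_bind[of UNIV]) (auto simp: UNIV_bool)

lemma prob_random_set: "measure_pmf.prob (random_set p E) {F. P F} = expect p E (\<lambda>F. of_bool (P F))"
proof -
  have "(\<lambda>F. of_bool (P F) :: real) = indicator {F. P F}" by (auto simp: indicator_def)
  then show ?thesis unfolding expect_def by simp
qed

lemma expect_mono:
  assumes "finite E" "0 \<le> p" "p \<le> 1" "\<And>F. F \<subseteq> E \<Longrightarrow> f F \<le> g F"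
  shows "expect p E f \<le> expect p E g"
  using assms(1,4)
proof (induction E arbitrary: f g rule: finite_induct)
  case (insert e E)
  have "expect p E (\<lambda>F. f (insert e F)) \<le> expect p E (\<lambda>F. g (insert e F))"
    by (rule insert.IH, rule insert.prems) auto
  moreover have "expect p E f \<le> expect p E g" using insert.prems by (intro insert.IH) auto
  ultimately show ?case using insert.hyps assms(2,3)
    by (simp add: expect_insert add_mono mult_left_mono)
qed simp

lemma expect_const: "expect p E (\<lambda>_. a) = a"
  by (simp add: expect_def)

lemma expect_cmult: "expect p E (\<lambda>F. a * f F) = a * expect p E f"
  by (simp add: expect_def)

lemma expect_add:
  assumes "finite E"
  shows "expect p E (\<lambda>F. f F + g F) = expect p E f + expect p E g"
  unfolding expect_def using finite_set_pmf_random_set[OF assms]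
  by (intro Bochner_Integration.integral_add) (auto intro: integrable_measure_pmf_finite)

lemma expect_cong:
  assumes "finite E" "0 \<le> p" "p \<le> 1" "\<And>F. F \<subseteq> E \<Longrightarrow> f F = g F"
  shows "expect p E f = expect p E g"
  using expect_mono[OF assms(1-3), of f g] expect_mono[OF assms(1-3), of g f] assms(4) by (simp add: order_antisym)

lemma expect_union:
  assumes "finite A" "finite B" "A \<inter> B = {}" "0 \<le> p" "p \<le> 1"
  shows "expect p (A \<union> B) f = expect p A (\<lambda>F. expect p B (\<lambda>H. f (F \<union> H)))"
  using assms(1,3)
proof (induction A arbitrary: f rule: finite_induct)
  case (insert e A)
  then show ?case using assms(2,4,5) by (simp add: expect_insert)
qed simp

text \<open>An edge is missing from the union of two independent samples iff it is missing from
  both. In the induction the same edge is revealed in both rounds; once it is in the first sample,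
  the second no longer matters.\<close>

lemma expect_sprinkle:
  assumes "finite E" "0 \<le> p1" "p1 \<le> 1" "0 \<le> p2" "p2 \<le> 1" "1 - p = (1 - p1) * (1 - p2)"
  shows "expect p E f = expect p1 E (\<lambda>A. expect p2 E (\<lambda>B. f (A \<union> B)))"
  using assms(1)
proof (induction E arbitrary: f rule: finite_induct)
  case (insert e E)
  have p: "p = p1 + (1 - p1) * p2" using assms(6) by (simp add: algebra_simps)
  then have p01: "0 \<le> p" "p \<le> 1"
    using assms(2-6) by (auto intro!: add_nonneg_nonneg mult_nonneg_nonneg)
       (metis assms(6) diff_ge_0_iff_ge zero_le_mult_iff)
  have "expect p1 (insert e E) (\<lambda>A. expect p2 (insert e E) (\<lambda>B. f (A \<union> B))) =
    p1 * expect p1 E (\<lambda>A. expect p2 E (\<lambda>B. f (insert e (A \<union> B)))) +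
    (1 - p1) * expect p1 E (\<lambda>A. p2 * expect p2 E (\<lambda>B. f (insert e (A \<union> B))) + (1 - p2) * expect p2 E (\<lambda>B. f (A \<union> B)))"
    using insert.hyps assms(2-5) by (simp add: expect_insert) (simp add: algebra_simps)
  also have "\<dots> = (p1 + (1 - p1) * p2) * expect p1 E (\<lambda>A. expect p2 E (\<lambda>B. f (insert e (A \<union> B)))) +
     (1 - p1) * (1 - p2) * expect p1 E (\<lambda>A. expect p2 E (\<lambda>B. f (A \<union> B)))"
    unfolding expect_add[OF insert.hyps(1)] expect_cmult by (simp add: algebra_simps)
  also have "\<dots> = p * expect p E (\<lambda>F. f (insert e F)) + (1 - p) * expect p E f"
    using insert.IH[of f] insert.IH[of "\<lambda>F. f (insert e F)"] p assms(6) by simp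
  finally show ?case using insert.hyps p01 by (simp add: expect_insert)
qed simp

section \<open>Exploration of the first round\<close>

text \<open>A derivation records the order of growth; read backwards it removes leaves one by one,
  which is how the tree is cut later. The rules constrain \<open>t\<close> only on the tree, so that
  a single counter can also remember the children in trees that have died out while a new root is
  planted.\<close>

inductive btree :: "nat \<Rightarrow> 'a set set \<Rightarrow> 'a set \<Rightarrow> ('a \<Rightarrow> nat) \<Rightarrow> bool" for D F where
  root: "t r = 0 \<Longrightarrow> btree D F {r} t"
| step: "btree D F T t \<Longrightarrow> v \<in> T \<Longrightarrow> w \<notin> T \<Longrightarrow> {v, w} \<in> F \<Longrightarrow> t v < D \<Longrightarrow> t w = 0 \<Longrightarrow>
    btree D F (insert w T) (t(v := Suc (t v)))"

lemma btree_mono: "btree D F T t \<Longrightarrow> F \<subseteq> F' \<Longrightarrow> btree D F' T t"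
  by (induction rule: btree.induct) (auto intro: btree.intros)

lemma btree_nonempty: "btree D F T t \<Longrightarrow> T \<noteq> {}"
  by (induction rule: btree.induct) auto

text \<open>Every additional edge has an end in \<open>U\<close>. The crude bound suffices because
  \<open>U\<close> is small in both uses: the vertices of dead trees, and the leftover of the
  cut.\<close>

lemma card_edges_in_Un_le:
  assumes "finite T" "finite U" "E \<subseteq> [V]\<^bsup>2\<^esup>"
  shows "card (edges_in E (T \<union> U)) \<le> card (edges_in E T) + card U * card (T \<union> U)"
proof -
  have "edges_in E (T \<union> U) \<subseteq> edges_in E T \<union> (\<lambda>(u, v). {u, v}) ` (U \<times> (T \<union> U))"
  proof
    fix e assume e: "e \<in> edges_in E (T \<union> U)"
    then have "e \<in> [T \<union> U]\<^bsup>2\<^esup>" using edges_in_nsets2[OF assms(3)] by blast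
    then obtain x y where xy: "e = {x, y}" "x \<in> T \<union> U" "y \<in> T \<union> U" by (rule in_nsets2E)
    consider "x \<in> U" | "y \<in> U" | "x \<in> T" "y \<in> T" using xy by blast
    then show "e \<in> edges_in E T \<union> (\<lambda>(u, v). {u, v}) ` (U \<times> (T \<union> U))"
    proof cases
      case 1 then have "e \<in> (\<lambda>(u, v). {u, v}) ` (U \<times> (T \<union> U))"
        using xy by (intro image_eqI[of _ _ "(x, y)"]) auto
      then show ?thesis by blast
    next
      case 2 then have "e \<in> (\<lambda>(u, v). {u, v}) ` (U \<times> (T \<union> U))"
        using xy by (intro image_eqI[of _ _ "(y, x)"]) auto
      then show ?thesis by blast
    next
      case 3 then show ?thesis using xy e by (auto simp: edges_in_def)
    qed
  qed
  moreover have fT: "finite (edges_in E T)"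
    using finite_edges[OF assms(1) edges_in_nsets2[OF assms(3)]] .
  ultimately have "card (edges_in E (T \<union> U)) \<le> card (edges_in E T \<union> (\<lambda>(u, v). {u, v}) ` (U \<times> (T \<union> U)))"
    using assms by (intro card_mono) auto
  also have "\<dots> \<le> card (edges_in E T) + card ((\<lambda>(u, v). {u, v}) ` (U \<times> (T \<union> U)))" by (rule card_Un_le)
  also have "\<dots> \<le> card (edges_in E T) + card (U \<times> (T \<union> U))"
    using assms by (intro add_left_mono card_image_le) auto
  finally show ?thesis by (simp add: card_cartesian_product)
qed

lemma card_boundary_edges_ge:
  assumes "finite V" "E \<subseteq> [V]\<^bsup>2\<^esup>" "R \<subseteq> V" "U \<subseteq> R" "finite Q"
    and Q: "\<And>v w. v \<in> U \<Longrightarrow> w \<in> V - R \<Longrightarrow> {v, w} \<in> E \<Longrightarrow> {v, w} \<in> Q"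
  shows "(\<Sum>v\<in>U. card (nbhd E v - R)) \<le> card Q"
proof -
  have fU: "finite U" using assms finite_subset by metis
  have fN: "finite (nbhd E v - R)" for v using nbhd_subset[OF assms(2)] assms(1) by (meson finite_Diff finite_subset)
  let ?g = "\<lambda>(v, w). {v, w}"
  let ?S = "SIGMA v:U. nbhd E v - R"
  have "inj_on ?g ?S" using assms(4) by (auto simp: inj_on_def doubleton_eq_iff)
  then have "card (?g ` ?S) = card ?S" by (rule card_image)
  also have "\<dots> = (\<Sum>v\<in>U. card (nbhd E v - R))" using fU fN by (intro card_SigmaI) auto
  finally have c: "card (?g ` ?S) = (\<Sum>v\<in>U. card (nbhd E v - R))" .
  have "?g ` ?S \<subseteq> Q"
  proof
    fix e assume "e \<in> ?g ` ?S"
    then obtain v w where "e = {v, w}" "v \<in> U" "w \<in> nbhd E v" "w \<notin> R" by auto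
    then show "e \<in> Q" using Q[of v w] nbhd_subset[OF assms(2), of v] by (auto simp: nbhd_def)
  qed
  then show ?thesis using c card_mono[OF assms(5)] by metis
qed

text \<open>When nothing is left to ask, every vertex of \<open>R\<close> with fewer than
  \<open>D\<close> children has queried all its edges out of \<open>R\<close>. At most
  \<open>card R / D\<close> vertices have \<open>D\<close> children, and at most
  \<open>2 * c * k * card R\<close> edge ends stay inside \<open>R\<close>; the remaining ends
  belong to distinct queried edges, as each such edge has exactly one end in \<open>R\<close>. Only
  the lower bound on the degrees enters.\<close>

lemma explored_edges_ge:
  fixes k D :: nat and c :: real
  assumes V: "finite V" and E: "E \<subseteq> [V]\<^bsup>2\<^esup>" and deg: "\<And>v. v \<in> V \<Longrightarrow> k \<le> card (nbhd E v)"
    and D: "D \<ge> 1" and R: "R \<subseteq> V" and Q: "finite Q"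
    and sum: "(\<Sum>v\<in>R. t v) \<le> card R"
    and sparse: "real (card (edges_in E R)) \<le> c * real k * real (card R)"
    and explored: "\<And>v w. v \<in> R \<Longrightarrow> t v < D \<Longrightarrow> w \<in> V - R \<Longrightarrow> {v, w} \<in> E \<Longrightarrow> {v, w} \<in> Q"
  shows "(1 - 1 / real D - 2 * c) * real k * real (card R) \<le> real (card Q)"
proof -
  have fR: "finite R" using R V finite_subset by blast
  define K where "K = {v \<in> R. D \<le> t v}"
  have KR: "K \<subseteq> R" and fK: "finite K" using fR by (auto simp: K_def)
  have "card K * D = (\<Sum>v\<in>K. D)" by simp
  also have "\<dots> \<le> (\<Sum>v\<in>K. t v)" by (intro sum_mono) (auto simp: K_def)
  also have "\<dots> \<le> (\<Sum>v\<in>R. t v)" using KR fR by (intro sum_mono2) auto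
  finally have "real (card K * D) \<le> real (card R)" using sum by (simp only: of_nat_le_iff)
  then have cK: "real (card K) \<le> real (card R) / real D" using D by (simp add: field_simps)
  have "(\<Sum>v\<in>R - K. card (nbhd E v - R)) \<le> card Q"
    using explored KR by (intro card_boundary_edges_ge[OF V E R _ Q]) (auto simp: K_def)
  then have "(\<Sum>v\<in>R - K. real (card (nbhd E v - R))) \<le> real (card Q)"
    by (simp only: of_nat_sum[symmetric] of_nat_le_iff)
  moreover have "(\<Sum>v\<in>R - K. real k - real (card (nbhd E v \<inter> R))) \<le> (\<Sum>v\<in>R - K. real (card (nbhd E v - R)))"
  proof (rule sum_mono)
    fix v assume "v \<in> R - K"
    then have "k \<le> card (nbhd E v)" using deg R by blast
    moreover have "card (nbhd E v) = card (nbhd E v \<inter> R) + card (nbhd E v - R)"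
      using nbhd_subset[OF E, of v] V by (metis Diff_disjoint Int_Diff_Un card_Un_disjoint finite_Diff finite_Int finite_subset inf.assoc inf_bot_right)
    ultimately show "real k - real (card (nbhd E v \<inter> R)) \<le> real (card (nbhd E v - R))" by simp
  qed
  moreover have "(\<Sum>v\<in>R - K. real k - real (card (nbhd E v \<inter> R))) =
      real k * (real (card R) - real (card K)) - (\<Sum>v\<in>R - K. real (card (nbhd E v \<inter> R)))"
    using KR fK fR card_mono[OF fR KR] by (simp add: sum_subtractf card_Diff_subset of_nat_diff)
  moreover have "(\<Sum>v\<in>R - K. real (card (nbhd E v \<inter> R))) \<le> (\<Sum>v\<in>R. real (card (nbhd E v \<inter> R)))"
    using fR by (intro sum_mono2) auto
  moreover have "(\<Sum>v\<in>R. real (card (nbhd E v \<inter> R))) = 2 * real (card (edges_in E R))"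
    using handshake_in[OF fR E] by (metis of_nat_mult of_nat_numeral of_nat_sum)
  moreover have "real k * (real (card R) - real (card R) / real D) \<le> real k * (real (card R) - real (card K))"
    using cK by (intro mult_left_mono) auto
  ultimately have "real k * (real (card R) - real (card R) / real D) - 2 * (c * real k * real (card R)) \<le> real (card Q)"
    using sparse by linarith
  then show ?thesis by (simp add: algebra_simps)
qed

text \<open>The tree must consist of edges of \<open>F\<close>, but its density is measured in
  \<open>E\<close>: those are the edges available to the second round.\<close>

definition dense_btree :: "nat \<Rightarrow> real \<Rightarrow> 'a set \<Rightarrow> 'a set set \<Rightarrow> 'a set set \<Rightarrow> bool" where
  "dense_btree D a V E F \<longleftrightarrow> (\<exists>T t. btree D F T t \<and> T \<subseteq> V \<and> a * real (card T) \<le> real (card (edges_in E T)))"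

text \<open>\<open>T\<close> is the tree currently grown, \<open>t v\<close> the number of children of \<open>v\<close> found so far, \<open>U\<close> the union
  of the trees that died out, \<open>Q\<close> the set of queried edges and \<open>X\<close> the set of those found open.
  The bound is an exponential martingale in the number of queries and of positive answers, so one
  inequality controls all times at which the exploration could get stuck.\<close>

lemma exploration_step_bound:
  fixes k D :: nat and c \<gamma> \<beta> p \<theta> \<nu> M q0 :: real and V :: "'a set"
  assumes V: "finite V" and E: "E \<subseteq> [V]\<^bsup>2\<^esup>" and deg: "\<And>v. v \<in> V \<Longrightarrow> k \<le> card (nbhd E v)"
    and D: "D \<ge> 1" and k: "k \<ge> 1" and p: "0 \<le> p" "p \<le> 1" and c: "c \<le> 1 / 2"
    and \<beta>: "\<beta> = 1 - 1 / real D - 2 * c" "\<beta> > 0"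
    and \<theta>: "\<theta> > 0" and \<nu>: "\<nu> > 0" and M: "M > 0" and step: "p * (\<theta> * \<nu>) + (1 - p) * \<nu> \<le> 1"
    and stuck: "\<And>x q :: nat. q0 \<le> real q \<Longrightarrow> \<beta> * real k * real x \<le> real q \<Longrightarrow> 1 \<le> M * \<theta> ^ x * \<nu> ^ q"
    and q0: "q0 \<le> \<gamma> * \<beta> * real k * real k"
    and T: "btree D X T t" "T \<subseteq> V" and U: "U \<subseteq> V" "T \<inter> U = {}" "real (card U) \<le> \<gamma> * real k"
    and Q: "Q \<subseteq> E" and sum: "(\<Sum>v\<in>T \<union> U. t v) \<le> card (T \<union> U)"
    and zero: "\<And>v. v \<in> V - (T \<union> U) \<Longrightarrow> t v = 0"
    and dead: "\<And>v w. v \<in> U \<Longrightarrow> t v < D \<Longrightarrow> w \<in> V - U \<Longrightarrow> {v, w} \<in> E \<Longrightarrow> {v, w} \<in> Q"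
  shows "expect p (E - Q) (\<lambda>A. of_bool (\<not> dense_btree D ((c - \<gamma>) * real k) V E (X \<union> A)))
    \<le> M * \<theta> ^ (\<Sum>v\<in>T \<union> U. t v) * \<nu> ^ card Q"
  using T U Q sum zero dead
\<comment> \<open>A query shrinks \<open>E - Q\<close>; the death of a tree leaves \<open>Q\<close>
  alone but moves the tree into \<open>U\<close> and so shrinks \<open>V - U\<close>.\<close>
proof (induction "card (E - Q) + card (V - U)" arbitrary: T t U Q X rule: less_induct)
  case less
  note T = less.prems(1,2) and U = less.prems(3-5) and Q = less.prems(6) and sum = less.prems(7)
    and zero = less.prems(8) and dead = less.prems(9)
  have fE: "finite E" by (rule finite_edges[OF V E])
  have fQ: "finite Q" using Q fE finite_subset by blast
  define R where "R = T \<union> U"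
  have RV: "R \<subseteq> V" using T U by (auto simp: R_def)
  have fin: "finite T" "finite U" "finite R" using T U RV V finite_subset by blast+
  let ?good = "dense_btree D ((c - \<gamma>) * real k) V E"
  have nonneg: "0 \<le> M * \<theta> ^ x * \<nu> ^ y" for x y using M \<theta> \<nu> by simp
  have le1: "expect p (E - Q) (\<lambda>A. of_bool (\<not> ?good (X \<union> A))) \<le> 1"
    using expect_mono[of "E - Q" p "\<lambda>A. of_bool (\<not> ?good (X \<union> A))" "\<lambda>_. 1"] fE p by (simp add: expect_const)
  consider (dense) "c * real k * real (card R) \<le> real (card (edges_in E R))"
    | (query) v w where "v \<in> T" "w \<in> V - R" "t v < D" "{v, w} \<in> E" "{v, w} \<notin> Q"
    | (stuck) "real (card (edges_in E R)) \<le> c * real k * real (card R)"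
        "\<not> c * real k * real (card R) \<le> real (card (edges_in E R))"
        "\<And>v w. v \<in> T \<Longrightarrow> w \<in> V - R \<Longrightarrow> t v < D \<Longrightarrow> {v, w} \<in> E \<Longrightarrow> {v, w} \<in> Q"
    by (meson linear)
  then show ?case
  proof cases
    case dense
    have "real (card (edges_in E R)) \<le> real (card (edges_in E T) + card U * card R)"
      unfolding R_def of_nat_le_iff using fin by (intro card_edges_in_Un_le[OF _ _ E])
    moreover have "real (card U) * real (card R) \<le> \<gamma> * real k * real (card R)"
      using U by (intro mult_right_mono) auto
    \<comment> \<open>Discarding the dead trees costs at most \<gamma> * k edges per vertex of
      \<open>R\<close>, which is the drop from \<open>c\<close> to
      \<open>c - \<gamma>\<close>.\<close>
    ultimately have a: "(c - \<gamma>) * real k * real (card R) \<le> real (card (edges_in E T))"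
      using dense by (simp add: algebra_simps)
    have "(c - \<gamma>) * real k * real (card T) \<le> real (card (edges_in E T))"
    proof (cases "c - \<gamma> \<ge> 0")
      case True
      then have "(c - \<gamma>) * real k * real (card T) \<le> (c - \<gamma>) * real k * real (card R)"
        using fin by (intro mult_left_mono) (auto simp: R_def intro!: card_mono)
      then show ?thesis using a by linarith
    next
      case False
      then have "(c - \<gamma>) * real k * real (card T) \<le> 0" by (simp add: mult_nonpos_nonneg)
      then show ?thesis by linarith
    qed
    then have "?good (X \<union> A)" for A
      unfolding dense_btree_def using btree_mono[OF T(1), of "X \<union> A"] T(2) by blast
    then show ?thesis using nonneg by (simp add: expect_const)
  next
    case query
    define e where "e = {v, w}"
    define Q' where "Q' = insert e Q"
    have e: "e \<in> E" "e \<notin> Q" using query by (auto simp: e_def)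
    have EQ: "E - Q = insert e (E - Q')" using e by (auto simp: Q'_def)
    have cQ': "card Q' = Suc (card Q)" using e fQ by (simp add: Q'_def)
    have smaller: "card (E - Q') + card (V - U) < card (E - Q) + card (V - U)"
      unfolding EQ using fE by (simp add: Q'_def)
    have wR: "w \<notin> T" "w \<notin> U" "w \<in> V" "t w = 0" "v \<noteq> w" using query zero by (auto simp: R_def)
    have vU: "v \<notin> U" using query(1) U(2) by blast
    let ?t = "t(v := Suc (t v))"
    have "(\<Sum>x\<in>insert w T \<union> U. ?t x) = (\<Sum>x\<in>insert w (R - {v}). ?t x) + ?t v"
      using query(1) fin wR by (subst sum.remove[of _ v]) (auto simp: R_def insert_Diff_if)
    also have "(\<Sum>x\<in>insert w (R - {v}). ?t x) = (\<Sum>x\<in>R - {v}. t x)"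
      using fin wR by (subst sum.insert) (auto simp: R_def intro!: sum.cong)
    also have "\<dots> + ?t v = Suc (\<Sum>x\<in>R. t x)"
      using query(1) fin by (subst (2) sum.remove[of _ v]) (auto simp: R_def)
    finally have sum': "(\<Sum>x\<in>insert w T \<union> U. ?t x) = Suc (\<Sum>x\<in>T \<union> U. t x)" by (simp add: R_def)
    have "card (insert w T \<union> U) = Suc (card (T \<union> U))" using wR fin by simp
    have IH1: "expect p (E - Q') (\<lambda>A. of_bool (\<not> ?good (insert e X \<union> A)))
        \<le> M * \<theta> ^ (\<Sum>x\<in>insert w T \<union> U. ?t x) * \<nu> ^ card Q'"
    proof (rule less.hyps[OF smaller])
      show "btree D (insert e X) (insert w T) ?t"
        using btree_mono[OF T(1), of "insert e X"] query wR
        by (intro btree.step) (auto simp: e_def)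
      show "(\<Sum>x\<in>insert w T \<union> U. ?t x) \<le> card (insert w T \<union> U)"
        unfolding sum' using sum \<open>card (insert w T \<union> U) = Suc (card (T \<union> U))\<close> by simp
      show "?t x = 0" if "x \<in> V - (insert w T \<union> U)" for x using that zero[of x] query(1) by auto
      show "{x, y} \<in> Q'" if "x \<in> U" "?t x < D" "y \<in> V - U" "{x, y} \<in> E" for x y
      proof -
        have "x \<noteq> v" using that vU by blast
        then show ?thesis using dead[of x y] that by (simp add: Q'_def)
      qed
    qed (use T U Q e wR in \<open>auto simp: Q'_def\<close>)
    have IH2: "expect p (E - Q') (\<lambda>A. of_bool (\<not> ?good (X \<union> A)))
        \<le> M * \<theta> ^ (\<Sum>x\<in>T \<union> U. t x) * \<nu> ^ card Q'"
      by (rule less.hyps[OF smaller T U _ sum zero]) (use Q e dead in \<open>auto simp: Q'_def\<close>)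
    have "expect p (E - Q) (\<lambda>A. of_bool (\<not> ?good (X \<union> A))) =
      p * expect p (E - Q') (\<lambda>A. of_bool (\<not> ?good (insert e X \<union> A))) +
      (1 - p) * expect p (E - Q') (\<lambda>A. of_bool (\<not> ?good (X \<union> A)))"
      unfolding EQ using fE p by (subst expect_insert) (auto simp: Q'_def)
    also have "\<dots> \<le> p * (M * \<theta> ^ Suc (\<Sum>x\<in>T \<union> U. t x) * \<nu> ^ Suc (card Q)) +
      (1 - p) * (M * \<theta> ^ (\<Sum>x\<in>T \<union> U. t x) * \<nu> ^ Suc (card Q))"
      using IH1 IH2 p unfolding sum' cQ' by (intro add_mono mult_left_mono) auto
    also have "\<dots> = (M * \<theta> ^ (\<Sum>x\<in>T \<union> U. t x) * \<nu> ^ card Q) * (p * (\<theta> * \<nu>) + (1 - p) * \<nu>)"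
      by (simp add: algebra_simps)
    \<comment> \<open>The supermartingale property: averaged over the answer, one query does not
      increase the potential.\<close>
    also have "\<dots> \<le> (M * \<theta> ^ (\<Sum>x\<in>T \<union> U. t x) * \<nu> ^ card Q) * 1"
      using step nonneg by (intro mult_left_mono) auto
    finally show ?thesis by simp
  next
    case stuck
    have Qb: "\<beta> * real k * real (card R) \<le> real (card Q)"
      unfolding \<beta>(1)
    proof (rule explored_edges_ge[OF V E deg D RV fQ sum[folded R_def] stuck(1)])
      fix x y assume "x \<in> R" "t x < D" "y \<in> V - R" "{x, y} \<in> E"
      then show "{x, y} \<in> Q" using stuck(3)[of x y] dead[of x y] by (auto simp: R_def)
    qed
    \<comment> \<open>After \<open>q0\<close> queries a stuck exploration has potential at least 1
      and the claim is trivial. Before that, \<open>R\<close> has at most \<gamma> * k vertices, so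
      all of it may be declared dead and a new root chosen.\<close>
    show ?thesis
    proof (cases "q0 \<le> real (card Q)")
      case True
      have "\<beta> * real k * real (\<Sum>v\<in>T \<union> U. t v) \<le> \<beta> * real k * real (card R)"
        using sum \<beta>(2) unfolding R_def by (intro mult_left_mono) (auto simp del: of_nat_sum)
      then have "1 \<le> M * \<theta> ^ (\<Sum>v\<in>T \<union> U. t v) * \<nu> ^ card Q" using Qb by (intro assms(15)[OF True]) linarith
      then show ?thesis using le1 by linarith
    next
      case False
      have "\<beta> * real k * real (card R) \<le> \<beta> * real k * (\<gamma> * real k)"
        using Qb False q0 by (simp add: algebra_simps)
      then have cR: "real (card R) \<le> \<gamma> * real k" using \<beta>(2) k by (simp add: mult_le_cancel_left_pos)
      \<comment> \<open>The whole vertex set spans at least \<open>k * card V / 2\<close> edges, so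
        by \<open>c \<le> 1 / 2\<close> it would have been dense. Hence a fresh root exists.\<close>
      have "R \<noteq> V"
      proof
        assume "R = V"
        then have "edges_in E R = E" using E by (auto simp: edges_in_def nsets_def)
        have "(\<Sum>v\<in>V. k) \<le> (\<Sum>v\<in>V. card (nbhd E v))" using deg by (intro sum_mono)
        then have "card V * k \<le> 2 * card E" using handshake[OF V E] by simp
        then have "real (card V * k) \<le> real (2 * card E)" by (simp only: of_nat_le_iff)
        moreover have "c * (real k * real (card V)) \<le> 1 / 2 * (real k * real (card V))"
          using c by (intro mult_right_mono) auto
        ultimately show False using stuck(2) \<open>R = V\<close> \<open>edges_in E R = E\<close> by (simp add: algebra_simps)
      qed
      then obtain r where r: "r \<in> V" "r \<notin> R" using RV by blast
      have tr: "t r = 0" using zero r by (simp add: R_def)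
      obtain x where x: "x \<in> T" using btree_nonempty[OF T(1)] by blast
      have "V - R \<subset> V - U" using x U(2) T(2) by (auto simp: R_def)
      then have smaller: "card (E - Q) + card (V - R) < card (E - Q) + card (V - U)"
        using V by (simp add: psubset_card_mono)
      have sum': "(\<Sum>x\<in>{r} \<union> R. t x) = (\<Sum>x\<in>T \<union> U. t x)" using fin r tr by (simp add: R_def)
      have "expect p (E - Q) (\<lambda>A. of_bool (\<not> ?good (X \<union> A))) \<le> M * \<theta> ^ (\<Sum>x\<in>{r} \<union> R. t x) * \<nu> ^ card Q"
      proof (rule less.hyps[OF smaller])
        show "btree D X {r} t" using tr by (rule btree.root)
        show "(\<Sum>x\<in>{r} \<union> R. t x) \<le> card ({r} \<union> R)"
          unfolding sum' using sum r fin by (simp add: R_def)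
        show "t x = 0" if "x \<in> V - ({r} \<union> R)" for x using that zero[of x] by (simp add: R_def)
        show "{x, y} \<in> Q" if "x \<in> R" "t x < D" "y \<in> V - R" "{x, y} \<in> E" for x y
          using stuck(3)[of x y] dead[of x y] that by (auto simp: R_def)
      qed (use r RV cR Q in auto)
      then show ?thesis unfolding sum' .
    qed
  qed
qed

text \<open>At an arbitrary root, before any query, both exponents of the potential are 0 and its
  value is \<open>M\<close>.\<close>

lemma exploration:
  fixes k D :: nat and c \<gamma> \<beta> p \<theta> \<nu> M q0 :: real and V :: "'a set"
  assumes V: "finite V" "V \<noteq> {}" and E: "E \<subseteq> [V]\<^bsup>2\<^esup>" and deg: "\<And>v. v \<in> V \<Longrightarrow> k \<le> card (nbhd E v)"
    and D: "D \<ge> 1" and k: "k \<ge> 1" and p: "0 \<le> p" "p \<le> 1" and c: "c \<le> 1 / 2" and \<gamma>: "\<gamma> \<ge> 0"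
    and \<beta>: "\<beta> = 1 - 1 / real D - 2 * c" "\<beta> > 0"
    and \<theta>: "\<theta> > 0" and \<nu>: "\<nu> > 0" and M: "M > 0" and step: "p * (\<theta> * \<nu>) + (1 - p) * \<nu> \<le> 1"
    and stuck: "\<And>x q :: nat. q0 \<le> real q \<Longrightarrow> \<beta> * real k * real x \<le> real q \<Longrightarrow> 1 \<le> M * \<theta> ^ x * \<nu> ^ q"
    and q0: "q0 \<le> \<gamma> * \<beta> * real k * real k"
  shows "expect p E (\<lambda>A. of_bool (\<not> dense_btree D ((c - \<gamma>) * real k) V E A)) \<le> M"
proof -
  obtain r where r: "r \<in> V" using V by blast
  have "btree D {} {r} (\<lambda>_. 0)" by (rule btree.root) simp
  then have "expect p (E - {}) (\<lambda>A. of_bool (\<not> dense_btree D ((c - \<gamma>) * real k) V E ({} \<union> A)))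
    \<le> M * \<theta> ^ (\<Sum>v\<in>{r} \<union> {}. 0) * \<nu> ^ card ({} :: 'a set set)"
    using r \<gamma> by (intro exploration_step_bound[OF V(1) E deg D k p c \<beta> \<theta> \<nu> M step stuck q0]) auto
  then show ?thesis by simp
qed

section \<open>Splitting the tree and sprinkling\<close>

text \<open>Cut off pieces from the leaves upwards: the bag \<open>B v\<close> collects what is left below \<open>v\<close>; when \<open>v\<close> is
  the last remaining leaf, its bag becomes a piece if it is large enough and is merged into the bag
  of its parent otherwise.\<close>

lemma btree_bags_split:
  fixes L D :: nat
  assumes "btree D F T t" "L \<ge> 1"
    and "\<And>v. v \<in> T \<Longrightarrow> v \<in> B v \<and> conn F (B v) \<and> finite (B v) \<and> card (B v) \<le> 1 + (L - 1) * (D - t v)"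
    and "\<And>u v. u \<in> T \<Longrightarrow> v \<in> T \<Longrightarrow> u \<noteq> v \<Longrightarrow> B u \<inter> B v = {}"
  shows "\<exists>P. finite P \<and> (\<forall>S\<in>P. conn F S \<and> S \<subseteq> (\<Union>v\<in>T. B v) \<and> L \<le> card S \<and> card S \<le> 1 + (L - 1) * D) \<and>
    disjoint P \<and> card ((\<Union>v\<in>T. B v) - \<Union>P) < L"
  using assms
proof (induction arbitrary: B rule: btree.induct)
  case (root t r)
  then have B: "conn F (B r)" "card (B r) \<le> 1 + (L - 1) * D" by auto
  show ?case
  proof (cases "L \<le> card (B r)")
    case True
    then show ?thesis using B root.prems(1) by (intro exI[of _ "{B r}"]) auto
  next
    case False
    then show ?thesis by (intro exI[of _ "{}"]) auto
  qed
next
  case (step T t v w)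
  let ?t = "t(v := Suc (t v))"
  have bag: "x \<in> B x" "conn F (B x)" "finite (B x)" "card (B x) \<le> 1 + (L - 1) * (D - ?t x)"
    if "x \<in> insert w T" for x using step.prems(2)[OF that] by auto
  have dis: "B x \<inter> B y = {}" if "x \<in> insert w T" "y \<in> insert w T" "x \<noteq> y" for x y
    using step.prems(3)[OF that] .
  have wv: "w \<noteq> v" using step.hyps by blast
  have cv: "card (B v) \<le> 1 + (L - 1) * (D - Suc (t v))" using bag(4)[of v] step.hyps(2) by simp
  \<comment> \<open>\<open>w\<close> was added last and has no child left in the tree, so all
    \<open>D\<close> places for merged children may be filled.\<close>
  have cw: "card (B w) \<le> 1 + (L - 1) * D" using bag(4)[of w] step.hyps(6) wv by simp
  show ?case
  proof (cases "L \<le> card (B w)")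
    case True
    have "\<exists>P. finite P \<and> (\<forall>S\<in>P. conn F S \<and> S \<subseteq> (\<Union>v\<in>T. B v) \<and> L \<le> card S \<and> card S \<le> 1 + (L - 1) * D) \<and>
      disjoint P \<and> card ((\<Union>v\<in>T. B v) - \<Union>P) < L"
    proof (rule step.IH[OF step.prems(1)])
      fix x assume x: "x \<in> T"
      have "1 + (L - 1) * (D - ?t x) \<le> 1 + (L - 1) * (D - t x)"
        by (intro add_left_mono mult_left_mono) auto
      then show "x \<in> B x \<and> conn F (B x) \<and> finite (B x) \<and> card (B x) \<le> 1 + (L - 1) * (D - t x)"
        using bag[of x] x by (auto intro: order_trans)
    qed (use dis in auto)
    then obtain P where P: "finite P" "disjoint P" "card ((\<Union>v\<in>T. B v) - \<Union>P) < L"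
      "\<forall>S\<in>P. conn F S \<and> S \<subseteq> (\<Union>v\<in>T. B v) \<and> L \<le> card S \<and> card S \<le> 1 + (L - 1) * D"
      by (elim exE conjE)
    have dw: "B w \<inter> S = {}" if "S \<in> P" for S
    proof -
      have "S \<subseteq> (\<Union>v\<in>T. B v)" using P(4) that by blast
      moreover have "B w \<inter> B x = {}" if "x \<in> T" for x using dis[of w x] that step.hyps(3) by auto
      ultimately show ?thesis by blast
    qed
    have "disjoint (insert (B w) P)"
      using P(2) dw by (auto simp: disjoint_def pairwise_insert disjnt_def pairwise_def)
    moreover have "(\<Union>x\<in>insert w T. B x) - \<Union>(insert (B w) P) \<subseteq> (\<Union>v\<in>T. B v) - \<Union>P" by auto
    moreover have "finite (\<Union>v\<in>T. B v)"
    proof (cases "finite T")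
      case False
      moreover have "finite T" using step.hyps(1) by (induction rule: btree.induct) auto
      ultimately show ?thesis by simp
    qed (use bag(3) in auto)
    ultimately have "card ((\<Union>x\<in>insert w T. B x) - \<Union>(insert (B w) P)) < L"
      using P(3) by (meson card_mono finite_Diff le_less_trans)
    then show ?thesis using P(1,4) \<open>disjoint (insert (B w) P)\<close> True cw bag(2)[of w]
      by (intro exI[of _ "insert (B w) P"]) auto
  next
    case False
    define B' where "B' = B(v := B v \<union> B w)"
    have B'v: "B' v = B v \<union> B w" and B'x: "\<And>x. x \<noteq> v \<Longrightarrow> B' x = B x" by (auto simp: B'_def)
    have un: "(\<Union>x\<in>T. B' x) = (\<Union>x\<in>insert w T. B x)"
    proof -
      have "(\<Union>x\<in>T. B' x) = B' v \<union> (\<Union>x\<in>T - {v}. B' x)" using step.hyps(2) by auto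
      also have "(\<Union>x\<in>T - {v}. B' x) = (\<Union>x\<in>T - {v}. B x)" using B'x by auto
      finally show ?thesis using step.hyps(2) B'v by auto
    qed
    show ?thesis unfolding un[symmetric]
    proof (rule step.IH[OF step.prems(1)])
      fix x assume x: "x \<in> T"
      show "x \<in> B' x \<and> conn F (B' x) \<and> finite (B' x) \<and> card (B' x) \<le> 1 + (L - 1) * (D - t x)"
      proof (cases "x = v")
        case True
        have "conn F (B v \<union> B w)"
          by (rule conn_Un[OF bag(2) bag(2) bag(1) bag(1)]) (use step.hyps in auto)
        \<comment> \<open>Removing the child \<open>w\<close> lowers the child count of
          \<open>v\<close> from \<open>Suc (t v)\<close> to \<open>t v\<close>. In the bound this
          frees one more block of \<open>L - 1\<close>, just enough for a bag that is too small to
          be a piece.\<close>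
        moreover have "card (B v \<union> B w) \<le> 1 + (L - 1) * (D - t v)"
        proof -
          have "card (B v \<union> B w) \<le> 1 + (L - 1) * (D - Suc (t v)) + (L - 1)"
            using card_Un_le[of "B v" "B w"] cv False by linarith
          also have "\<dots> = 1 + (L - 1) * Suc (D - Suc (t v))" by simp
          also have "Suc (D - Suc (t v)) = D - t v" using step.hyps(5) by simp
          finally show ?thesis .
        qed
        ultimately show ?thesis using True B'v bag[of v] bag[of w] step.hyps(2) by auto
      next
        case False
        then show ?thesis using bag[of x] x B'x by simp
      qed
    next
      fix x y assume xy: "x \<in> T" "y \<in> T" "x \<noteq> y"
      have "B u \<inter> B w = {}" "B w \<inter> B u = {}" if "u \<in> T" for u
        using dis[of u w] dis[of w u] that step.hyps(3) by blast+
      then show "B' x \<inter> B' y = {}"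
        using dis[of x y] xy B'v B'x by (cases "x = v"; cases "y = v") auto
    qed
  qed
qed

text \<open>Starting from singleton bags, all pieces have size between \<open>L\<close> and
  \<open>D * L\<close>; the vertices outside the pieces are what remains in the bag of the root, too
  few for a piece.\<close>

lemma btree_split:
  fixes L D :: nat
  assumes "btree D F T t" "L \<ge> 1" "D \<ge> 1"
  shows "\<exists>P. finite P \<and> (\<forall>S\<in>P. conn F S \<and> S \<subseteq> T \<and> L \<le> card S \<and> card S \<le> D * L) \<and>
    disjoint P \<and> card (T - \<Union>P) < L"
proof -
  have "\<exists>P. finite P \<and> (\<forall>S\<in>P. conn F S \<and> S \<subseteq> (\<Union>v\<in>T. {v}) \<and> L \<le> card S \<and> card S \<le> 1 + (L - 1) * D) \<and>
    disjoint P \<and> card ((\<Union>v\<in>T. {v}) - \<Union>P) < L"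
    using assms by (intro btree_bags_split[of D F T t L "\<lambda>v. {v}"]) (auto simp: conn_singleton)
  moreover have "1 + (L - 1) * D \<le> D * L" using assms(2,3) by (cases L) auto
  ultimately show ?thesis by (auto intro: order_trans)
qed

section \<open>Lower tail for the number of classes hit by a random set\<close>

lemma expect_empty_indicator:
  assumes "finite C" "0 \<le> p" "p \<le> 1"
  shows "expect p C (\<lambda>F. if F = {} then 1 else z) = z + (1 - z) * (1 - p) ^ card C"
  using assms(1)
proof (induction C rule: finite_induct)
  case (insert e C)
  then show ?case using assms(2,3) by (simp add: expect_insert expect_const insert.IH) (simp add: algebra_simps)
qed simp

text \<open>This is the probability generating function of the number of hit classes: disjoint
  classes are hit independently, and each contributes the generating function of one
  indicator.\<close>

lemma expect_power_hits:
  fixes z :: real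
  assumes "finite I" "\<And>i. i \<in> I \<Longrightarrow> finite (C i)" "\<And>i j. i \<in> I \<Longrightarrow> j \<in> I \<Longrightarrow> i \<noteq> j \<Longrightarrow> C i \<inter> C j = {}"
    and p: "0 \<le> p" "p \<le> 1"
  shows "expect p (\<Union>i\<in>I. C i) (\<lambda>H. z ^ card {i \<in> I. H \<inter> C i \<noteq> {}}) =
    (\<Prod>i\<in>I. z + (1 - z) * (1 - p) ^ card (C i))"
  using assms(1-3)
proof (induction I rule: finite_induct)
  case (insert j I)
  let ?U = "\<Union>i\<in>I. C i"
  have fin: "finite (C j)" "finite ?U" using insert by auto
  have dj: "C j \<inter> ?U = {}"
  proof -
    have "C j \<inter> C i = {}" if "i \<in> I" for i using insert.prems(2)[of j i] that insert.hyps(2) by auto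
    then show ?thesis by blast
  qed
  let ?K = "expect p ?U (\<lambda>H. z ^ card {i \<in> I. H \<inter> C i \<noteq> {}})"
  have "expect p (\<Union>i\<in>insert j I. C i) (\<lambda>H. z ^ card {i \<in> insert j I. H \<inter> C i \<noteq> {}}) =
    expect p (C j) (\<lambda>F. expect p ?U (\<lambda>H. z ^ card {i \<in> insert j I. (F \<union> H) \<inter> C i \<noteq> {}}))"
    using expect_union[OF fin dj p] by simp
  also have "\<dots> = expect p (C j) (\<lambda>F. ?K * (if F = {} then 1 else z))"
  proof (rule expect_cong[OF fin(1) p])
    fix F assume F: "F \<subseteq> C j"
    have "expect p ?U (\<lambda>H. z ^ card {i \<in> insert j I. (F \<union> H) \<inter> C i \<noteq> {}}) =
      expect p ?U (\<lambda>H. (if F = {} then 1 else z) * z ^ card {i \<in> I. H \<inter> C i \<noteq> {}})"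
    proof (rule expect_cong[OF fin(2) p])
      fix H assume H: "H \<subseteq> ?U"
      have "{i \<in> insert j I. (F \<union> H) \<inter> C i \<noteq> {}} =
        (if F = {} then {} else {j}) \<union> {i \<in> I. H \<inter> C i \<noteq> {}}"
      proof -
        have "(F \<union> H) \<inter> C j \<noteq> {} \<longleftrightarrow> F \<noteq> {}" using F H dj by blast
        moreover have "(F \<union> H) \<inter> C i = H \<inter> C i" if "i \<in> I" for i using F dj that by blast
        ultimately show ?thesis by auto
      qed
      moreover have "j \<notin> {i \<in> I. H \<inter> C i \<noteq> {}}" using insert.hyps by simp
      ultimately show "z ^ card {i \<in> insert j I. (F \<union> H) \<inter> C i \<noteq> {}} =
        (if F = {} then 1 else z) * z ^ card {i \<in> I. H \<inter> C i \<noteq> {}}"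
        using insert.hyps(1) by simp
    qed
    then show "expect p ?U (\<lambda>H. z ^ card {i \<in> insert j I. (F \<union> H) \<inter> C i \<noteq> {}}) =
      ?K * (if F = {} then 1 else z)" by (simp add: expect_cmult)
  qed
  also have "\<dots> = ?K * (z + (1 - z) * (1 - p) ^ card (C j))"
    by (simp add: expect_cmult expect_empty_indicator[OF fin(1) p])
  also have "?K = (\<Prod>i\<in>I. z + (1 - z) * (1 - p) ^ card (C i))"
    using insert.prems by (intro insert.IH) auto
  finally show ?case using insert.hyps by (simp add: mult.commute)
qed simp

text \<open>From (1 - p)(1 + p) \<le> 1 and Bernoulli's inequality, (1 - p)^m \<le> 1 / (1 + p m),
  so a class is hit with probability at least p m / (1 + a). The left-hand side is the factor of the
  generating function at 1/2, unsimplified to match.\<close>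

lemma one_minus_power_le:
  fixes p a :: real and m :: nat
  assumes "0 \<le> p" "p \<le> 1" "p * real m \<le> a"
  shows "1 / 2 + (1 - 1 / 2) * (1 - p) ^ m \<le> exp (- (p * real m / (2 * (1 + a))))"
proof -
  have a: "0 \<le> a" using assms by (meson mult_nonneg_nonneg of_nat_0_le_iff order_trans)
  have pm: "0 \<le> p * real m" using assms by simp
  have "(1 - p) ^ m * (1 + p) ^ m = (1 - p * p) ^ m" by (simp add: power_mult_distrib[symmetric] algebra_simps)
  also have "\<dots> \<le> 1" using assms by (intro power_le_one) (auto simp: mult_le_one)
  finally have "(1 - p) ^ m * (1 + p) ^ m \<le> 1" .
  moreover have "(1 - p) ^ m * (1 + real m * p) \<le> (1 - p) ^ m * (1 + p) ^ m"
    using Bernoulli_inequality[of p m] assms by (intro mult_left_mono) auto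
  ultimately have "(1 - p) ^ m * (1 + p * real m) \<le> 1" by (simp add: mult.commute)
  then have "(1 - p) ^ m \<le> 1 / (1 + p * real m)" using pm by (simp add: field_simps)
  also have "\<dots> = 1 - p * real m / (1 + p * real m)" using pm by (simp add: field_simps)
  also have "\<dots> \<le> 1 - p * real m / (1 + a)"
    using pm assms a by (intro diff_left_mono divide_left_mono) (auto intro!: mult_pos_pos add_pos_nonneg)
  finally have "(1 - p) ^ m \<le> 1 - p * real m / (1 + a)" .
  moreover have "1 / 2 + (1 - 1 / 2) * y \<le> 1 + - (u / 2)" if "y \<le> 1 - u" for u y :: real
    using that by simp
  ultimately have "1 / 2 + (1 - 1 / 2) * (1 - p) ^ m \<le> 1 + - (p * real m / (1 + a) / 2)" by blast
  also have "\<dots> \<le> exp (- (p * real m / (1 + a) / 2))" by (rule exp_ge_add_one_self)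
  also have "p * real m / (1 + a) / 2 = p * real m / (2 * (1 + a))" by simp
  finally show ?thesis .
qed

text \<open>Exponential Markov inequality at base 1/2. As \<open>a\<close> bounds the expected
  number of chosen edges in a class, repeated hits of the same class cost no more than a factor
  \<open>1 + a\<close>. The 4 in the threshold \<open>x\<close> makes the moment at most exp (-
  2x).\<close>

lemma few_hits_unlikely:
  fixes a p :: real and N :: real
  assumes E: "finite E" and I: "finite I" and C: "\<And>i. i \<in> I \<Longrightarrow> C i \<subseteq> E"
    and dis: "\<And>i j. i \<in> I \<Longrightarrow> j \<in> I \<Longrightarrow> i \<noteq> j \<Longrightarrow> C i \<inter> C j = {}"
    and p: "0 \<le> p" "p \<le> 1" and a: "\<And>i. i \<in> I \<Longrightarrow> p * real (card (C i)) \<le> a" "a \<ge> 0"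
    and N: "N \<le> real (card (\<Union>i\<in>I. C i))"
  shows "expect p E (\<lambda>H. of_bool (real (card {i \<in> I. H \<inter> C i \<noteq> {}}) < p * N / (4 * (1 + a))))
    \<le> exp (- (p * N / (4 * (1 + a))))"
proof -
  define x where "x = p * N / (4 * (1 + a))"
  let ?U = "\<Union>i\<in>I. C i"
  let ?X = "\<lambda>H. card {i \<in> I. H \<inter> C i \<noteq> {}}"
  have U: "?U \<subseteq> E" "finite ?U" using C E finite_subset[of ?U E] by auto
  have fC: "finite (C i)" if "i \<in> I" for i using C[OF that] E finite_subset by blast
  have cU: "card ?U = (\<Sum>i\<in>I. card (C i))" using dis fC I by (intro card_UN_disjoint) auto
  have "expect p E (\<lambda>H. (1 / 2) ^ ?X H) = expect p (?U \<union> (E - ?U)) (\<lambda>H. (1 / 2) ^ ?X H)"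
    using U by (simp add: Un_absorb1)
  also have "\<dots> = expect p ?U (\<lambda>F. expect p (E - ?U) (\<lambda>H. (1 / 2) ^ ?X (F \<union> H)))"
    using U E p by (intro expect_union) auto
  also have "\<dots> = expect p ?U (\<lambda>F. (1 / 2) ^ ?X F)"
  proof (rule expect_cong[OF U(2) p])
    fix F assume "F \<subseteq> ?U"
    have "expect p (E - ?U) (\<lambda>H. (1 / 2 :: real) ^ ?X (F \<union> H)) = expect p (E - ?U) (\<lambda>H. (1 / 2) ^ ?X F)"
    proof (rule expect_cong[OF _ p])
      fix H assume "H \<subseteq> E - ?U"
      then have "(F \<union> H) \<inter> C i = F \<inter> C i" if "i \<in> I" for i using that by blast
      then have "{i \<in> I. (F \<union> H) \<inter> C i \<noteq> {}} = {i \<in> I. F \<inter> C i \<noteq> {}}" by auto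
      then show "(1 / 2 :: real) ^ ?X (F \<union> H) = (1 / 2) ^ ?X F" by simp
    qed (use E in simp)
    then show "expect p (E - ?U) (\<lambda>H. (1 / 2 :: real) ^ ?X (F \<union> H)) = (1 / 2) ^ ?X F" by (simp add: expect_const)
  qed
  also have "\<dots> = (\<Prod>i\<in>I. 1 / 2 + (1 - 1 / 2) * (1 - p) ^ card (C i))"
    using fC dis by (intro expect_power_hits[OF I _ _ p]) auto
  also have "\<dots> \<le> (\<Prod>i\<in>I. exp (- (p * real (card (C i)) / (2 * (1 + a)))))"
    using one_minus_power_le[OF p a(1)] p by (intro prod_mono) auto
  also have "\<dots> = exp (\<Sum>i\<in>I. - (p * real (card (C i)) / (2 * (1 + a))))" by (simp add: exp_sum[OF I])
  also have "(\<Sum>i\<in>I. - (p * real (card (C i)) / (2 * (1 + a)))) = - (p * real (card ?U) / (2 * (1 + a)))"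
    unfolding cU by (simp add: sum_negf sum_divide_distrib sum_distrib_left)
  also have "exp \<dots> \<le> exp (- (2 * x))"
  proof -
    have "p * N / (2 * (1 + a)) \<le> p * real (card ?U) / (2 * (1 + a))"
      using N p a(2) by (intro divide_right_mono mult_left_mono) auto
    moreover have "p * N / (2 * (1 + a)) = 2 * x" using a(2) by (simp add: x_def field_simps)
    ultimately show ?thesis by simp
  qed
  finally have mom: "expect p E (\<lambda>H. (1 / 2) ^ ?X H) \<le> exp (- (2 * x))" .
  have "expect p E (\<lambda>H. of_bool (real (?X H) < x)) \<le> expect p E (\<lambda>H. exp x * (1 / 2) ^ ?X H)"
  proof (rule expect_mono[OF E p])
    fix H
    \<comment> \<open>Because exp (-1) \<le> 1/2, the Markov step costs a factor exp x, half of the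
      available exponent.\<close>
    have "exp (- real (?X H)) \<le> (1 / 2) ^ ?X H"
    proof -
      have "exp (- 1) \<le> (1 / 2 :: real)"
        using exp_ge_add_one_self[of 1] by (simp add: exp_minus inverse_eq_divide field_simps)
      then have "exp (- 1) ^ ?X H \<le> (1 / 2 :: real) ^ ?X H" by (intro power_mono) auto
      then show ?thesis by (simp add: exp_of_nat_mult[symmetric])
    qed
    then have "exp x * exp (- real (?X H)) \<le> exp x * (1 / 2) ^ ?X H" by simp
    moreover have "1 \<le> exp x * exp (- real (?X H))" if "real (?X H) < x"
      using that by (simp add: mult_exp_exp)
    ultimately have "1 \<le> exp x * (1 / 2) ^ ?X H" if "real (?X H) < x" using that order_trans by blast
    then show "of_bool (real (?X H) < x) \<le> exp x * (1 / 2) ^ ?X H"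
      by (cases "real (?X H) < x") simp_all
  qed
  also have "\<dots> = exp x * expect p E (\<lambda>H. (1 / 2) ^ ?X H)" by (rule expect_cmult)
  also have "\<dots> \<le> exp x * exp (- (2 * x))" using mom by simp
  also have "\<dots> = exp (- x)" by (simp add: mult_exp_exp)
  finally show ?thesis by (simp add: x_def)
qed

text \<open>The index is the unordered pair of pieces itself, so the classes are indexed by the
  possible edges of the quotient graph.\<close>

definition between :: "'a set set \<Rightarrow> 'a set set \<Rightarrow> 'a set set" where
  "between E i = {e \<in> E. e \<subseteq> \<Union>i \<and> (\<forall>A\<in>i. e \<inter> A \<noteq> {})}"

lemma betweenE:
  assumes E: "E \<subseteq> [V]\<^bsup>2\<^esup>" and e: "e \<in> between E {A, B}" and AB: "A \<inter> B = {}"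
  obtains x y where "x \<in> A" "y \<in> B" "e = {x, y}"
proof -
  obtain x y where xy: "x \<in> e" "x \<in> A" "y \<in> e" "y \<in> B" using e by (auto simp: between_def)
  have "e \<in> [V]\<^bsup>2\<^esup>" using e E by (auto simp: between_def)
  then obtain u v where "e = {u, v}" by (rule in_nsets2E)
  then have "e = {x, y}" using xy AB by auto
  then show thesis using that xy by blast
qed

text \<open>Pairwise disjoint pieces can be read off from an edge. Hence different pairs have
  disjoint classes, as independence requires.\<close>

lemma between_determines_pair:
  assumes P: "disjoint P" and i: "i \<in> [P]\<^bsup>2\<^esup>" and e: "e \<in> between E i"
  shows "i = {A \<in> P. e \<inter> A \<noteq> {}}"
proof -
  obtain A B where AB: "i = {A, B}" "A \<in> P" "B \<in> P" using i by (rule in_nsets2E)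
  have "X = A \<or> X = B" if X: "X \<in> P" "e \<inter> X \<noteq> {}" for X
  proof -
    have "e \<subseteq> A \<union> B" using e AB by (auto simp: between_def)
    then have "A \<inter> X \<noteq> {} \<or> B \<inter> X \<noteq> {}" using X by blast
    then show ?thesis using P AB X unfolding disjoint_def by blast
  qed
  moreover have "e \<inter> A \<noteq> {}" "e \<inter> B \<noteq> {}" using e AB by (auto simp: between_def)
  ultimately show ?thesis using AB by blast
qed

lemma card_between_le:
  assumes E: "E \<subseteq> [V]\<^bsup>2\<^esup>" and AB: "A \<inter> B = {}" "finite A" "finite B"
  shows "card (between E {A, B}) \<le> card A * card B"
proof -
  have "between E {A, B} \<subseteq> (\<lambda>(x, y). {x, y}) ` (A \<times> B)"
  proof
    fix e assume "e \<in> between E {A, B}"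
    then obtain x y where "x \<in> A" "y \<in> B" "e = {x, y}" using betweenE[OF E _ AB(1)] by blast
    then show "e \<in> (\<lambda>(x, y). {x, y}) ` (A \<times> B)" by (intro image_eqI[of _ _ "(x, y)"]) auto
  qed
  then have "card (between E {A, B}) \<le> card ((\<lambda>(x, y). {x, y}) ` (A \<times> B))" using AB by (intro card_mono) auto
  also have "\<dots> \<le> card (A \<times> B)" using AB by (intro card_image_le) auto
  finally show ?thesis by (simp add: card_cartesian_product)
qed

text \<open>Lost are the edges inside a piece, at most \<open>D * L\<close> per vertex, and those
  touching the fewer than \<open>L\<close> leftover vertices. For \<open>L\<close> of order \<surd>k
  this is negligible against a density of order k.\<close>

lemma card_edges_between_pieces_ge:
  fixes D L :: nat
  assumes E: "E \<subseteq> [V]\<^bsup>2\<^esup>" and T: "finite T" and P: "finite P" "disjoint P" "\<And>S. S \<in> P \<Longrightarrow> S \<subseteq> T"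
    and small: "\<And>S. S \<in> P \<Longrightarrow> card S \<le> D * L" and rest: "card (T - \<Union>P) < L"
  shows "card (edges_in E T) \<le> card (\<Union>i\<in>[P]\<^bsup>2\<^esup>. between E i) + (D + 1) * L * card T"
proof -
  have UT: "\<Union>P \<subseteq> T" using P by blast
  have fU: "finite (\<Union>P)" using UT T finite_subset by blast
  have fS: "finite S" if "S \<in> P" for S using P(3)[OF that] T finite_subset by blast
  let ?X = "\<Union>i\<in>[P]\<^bsup>2\<^esup>. between E i" and ?Y = "\<Union>S\<in>P. edges_in E S"
  have fin_in: "finite (edges_in E S)" if "finite S" for S
    using finite_edges[OF that edges_in_nsets2[OF E]] .
  have sub: "edges_in E (\<Union>P) \<subseteq> ?X \<union> ?Y"
  proof
    fix e assume e: "e \<in> edges_in E (\<Union>P)"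
    then have "e \<in> [\<Union>P]\<^bsup>2\<^esup>" using edges_in_nsets2[OF E] by blast
    then obtain x y where xy: "e = {x, y}" "x \<in> \<Union>P" "y \<in> \<Union>P" by (rule in_nsets2E)
    then obtain A B where AB: "A \<in> P" "x \<in> A" "B \<in> P" "y \<in> B" by blast
    have eE: "e \<in> E" using e by (simp add: edges_in_def)
    show "e \<in> ?X \<union> ?Y"
    proof (cases "A = B")
      case True
      then have "e \<in> edges_in E A" using AB xy eE by (simp add: edges_in_def)
      then show ?thesis using AB by blast
    next
      case False
      then have "{A, B} \<in> [P]\<^bsup>2\<^esup>" using AB by (simp add: doubleton_in_nsets2_iff)
      moreover have "e \<in> between E {A, B}" using AB xy eE by (auto simp: between_def)
      ultimately show ?thesis by blast
    qed
  qed
  have "?X \<subseteq> edges_in E (\<Union>P)"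
  proof
    fix e assume "e \<in> ?X"
    then obtain i where i: "i \<in> [P]\<^bsup>2\<^esup>" "e \<in> between E i" by blast
    then have "\<Union>i \<subseteq> \<Union>P" by (auto simp: nsets_def)
    then show "e \<in> edges_in E (\<Union>P)" using i by (auto simp: between_def edges_in_def)
  qed
  then have fX: "finite ?X" using fin_in[OF fU] finite_subset by blast
  have "card (edges_in E (\<Union>P)) \<le> card (?X \<union> ?Y)"
    using sub fX fin_in fS P(1) by (intro card_mono) auto
  also have "\<dots> \<le> card ?X + card ?Y" by (rule card_Un_le)
  also have "card ?Y \<le> (\<Sum>S\<in>P. card (edges_in E S))" by (rule card_UN_le[OF P(1)])
  also have "\<dots> \<le> (\<Sum>S\<in>P. D * L * card S)"
  proof (rule sum_mono)
    fix S assume S: "S \<in> P"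
    have "2 * card (edges_in E S) \<le> card S * (card S - 1)" by (rule twice_card_edges_le[OF fS[OF S] E])
    also have "\<dots> \<le> card S * (D * L)" using small[OF S] by (intro mult_left_mono) auto
    finally show "card (edges_in E S) \<le> D * L * card S" by (simp add: mult.commute)
  qed
  also have "\<dots> = D * L * card (\<Union>P)"
  proof -
    have "card (\<Union>P) = (\<Sum>S\<in>P. card S)"
      using P(2) fS by (intro card_Union_disjoint) auto
    then show ?thesis by (simp add: sum_distrib_left)
  qed
  also have "\<dots> \<le> D * L * card T" using UT T by (intro mult_left_mono card_mono) auto
  finally have "card (edges_in E (\<Union>P)) \<le> card ?X + D * L * card T" by simp
  moreover have "card (edges_in E T) \<le> card (edges_in E (\<Union>P)) + card (T - \<Union>P) * card T"
  proof -
    have "\<Union>P \<union> (T - \<Union>P) = T" using UT by blast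
    then show ?thesis using card_edges_in_Un_le[of "\<Union>P" "T - \<Union>P", OF _ _ E] fU T by simp
  qed
  moreover have "card (T - \<Union>P) * card T \<le> L * card T" using rest by (intro mult_right_mono) auto
  moreover have "(D + 1) * L * card T = D * L * card T + L * card T" by (simp add: algebra_simps)
  ultimately show ?thesis by linarith
qed

lemma quotient_is_minor:
  assumes E: "E \<subseteq> [V]\<^bsup>2\<^esup>" and P: "disjoint P" "\<And>S. S \<in> P \<Longrightarrow> S \<subseteq> V \<and> conn F S"
  shows "is_minor (UGraph P {i \<in> [P]\<^bsup>2\<^esup>. H \<inter> between E i \<noteq> {}}) (UGraph V (F \<union> H))"
  unfolding is_minor_iff ugraph.sel
proof (intro exI[of _ "\<lambda>S. S"] conjI ballI impI)
  fix A assume "A \<in> P"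
  then show "conn (F \<union> H) A" "A \<subseteq> V" using P(2) conn_mono[of F A "F \<union> H"] by auto
next
  fix A B assume "A \<in> P" "B \<in> P" "A \<noteq> B"
  then show "A \<inter> B = {}" using P(1) by (auto simp: disjoint_def)
next
  fix A B assume AB: "A \<in> P" "B \<in> P" "{A, B} \<in> {i \<in> [P]\<^bsup>2\<^esup>. H \<inter> between E i \<noteq> {}}"
  then have "A \<noteq> B" by (simp add: doubleton_in_nsets2_iff)
  then have dis: "A \<inter> B = {}" using P(1) AB by (auto simp: disjoint_def)
  obtain e where e: "e \<in> H" "e \<in> between E {A, B}" using AB by auto
  obtain x y where "x \<in> A" "y \<in> B" "e = {x, y}" by (rule betweenE[OF E e(2) dis])
  then show "\<exists>u\<in>A. \<exists>v\<in>B. {u, v} \<in> F \<union> H" using e(1) by auto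
qed

text \<open>The vertices of the minor are vertex sets, because it arises as a quotient by pieces;
  the theorem on average degree is applied at this type.\<close>

definition dense_minor :: "nat \<Rightarrow> 'a set \<Rightarrow> 'a set set \<Rightarrow> bool" where
  "dense_minor d V F \<longleftrightarrow> (\<exists>(P :: 'a set set) Q. finite P \<and> P \<noteq> {} \<and> Q \<subseteq> [P]\<^bsup>2\<^esup> \<and> d * card P \<le> card Q \<and>
     is_minor (UGraph P Q) (UGraph V F))"

text \<open>By \<open>bL\<close> at least half of the edges spanned by the tree run between
  different pieces. Each pair of pieces that is hit gives one edge of the quotient, and
  \<open>a\<close> bounds the expected number of new edges per pair.\<close>

lemma sprinkling:
  fixes D L d :: nat and a b p :: real
  assumes V: "finite V" and E: "E \<subseteq> [V]\<^bsup>2\<^esup>" and L: "L \<ge> 1" and D: "D \<ge> 1" and b: "b > 0"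
    and good: "dense_btree D b V E F" and bL: "2 * (real D + 1) * real L \<le> b"
    and p: "0 \<le> p" "p \<le> 1" and a: "p * (real D * real L)\<^sup>2 \<le> a" "a \<ge> 0"
    and d: "real d \<le> p * b * real L / (8 * (1 + a))"
  shows "expect p E (\<lambda>H. of_bool (\<not> dense_minor d V (F \<union> H))) \<le> exp (- (p * b * b / (4 * (1 + a))))"
proof -
  obtain T t where T: "btree D F T t" "T \<subseteq> V" and dense: "b * real (card T) \<le> real (card (edges_in E T))"
    using good unfolding dense_btree_def by blast
  have fT: "finite T" using T(2) V finite_subset by blast
  have cT: "card T > 0" using btree_nonempty[OF T(1)] fT by (simp add: card_gt_0_iff)
  have fE: "finite E" by (rule finite_edges[OF V E])
  \<comment> \<open>Density \<open>b\<close> forces at least \<open>2 * b\<close> vertices. This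
    guarantees a piece and turns a tail bound in \<open>card T\<close> into one in \<open>b\<close>
    alone.\<close>
  have T2: "2 * b \<le> real (card T)"
  proof -
    have "2 * card (edges_in E T) \<le> card T * card T"
      by (rule order_trans[OF twice_card_edges_le[OF fT E]]) simp
    then have "real (2 * card (edges_in E T)) \<le> real (card T * card T)" by (simp only: of_nat_le_iff)
    then have "2 * b * real (card T) \<le> real (card T) * real (card T)" using dense by simp
    then show ?thesis using cT by simp
  qed
  obtain P where P: "finite P" "disjoint P" "card (T - \<Union>P) < L"
    and PS: "\<forall>S\<in>P. conn F S \<and> S \<subseteq> T \<and> L \<le> card S \<and> card S \<le> D * L"
    using btree_split[OF T(1) L D] by (elim exE conjE)
  have fS: "finite S" if "S \<in> P" for S using PS that fT finite_subset by blast
  have "real L \<le> 2 * (real D + 1) * real L" using L by simp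
  then have "L \<le> card T" using bL T2 b by linarith
  then have Pne: "P \<noteq> {}" using P(3) by auto
  let ?I = "[P]\<^bsup>2\<^esup>" and ?C = "between E"
  define N where "N = b * real (card T) / 2"
  have fI: "finite ?I" using P(1) by (rule finite_imp_finite_nsets)
  have "card (edges_in E T) \<le> card (\<Union>i\<in>?I. ?C i) + (D + 1) * L * card T"
    using PS P by (intro card_edges_between_pieces_ge[OF E fT]) auto
  then have "real (card (edges_in E T)) \<le> real (card (\<Union>i\<in>?I. ?C i) + (D + 1) * L * card T)"
    by (simp only: of_nat_le_iff)
  moreover have "2 * (real D + 1) * real L * real (card T) \<le> b * real (card T)"
    using bL by (intro mult_right_mono) auto
  ultimately have N: "N \<le> real (card (\<Union>i\<in>?I. ?C i))"
    using dense unfolding N_def by (simp add: algebra_simps)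
  have ac: "p * real (card (?C i)) \<le> a" if i: "i \<in> ?I" for i
  proof -
    obtain A B where AB: "i = {A, B}" "A \<in> P" "B \<in> P" "A \<noteq> B" using i by (rule in_nsets2E)
    then have "A \<inter> B = {}" using P(2) by (auto simp: disjoint_def)
    then have "card (?C i) \<le> card A * card B" using AB fS card_between_le[OF E] by simp
    also have "\<dots> \<le> (D * L) * (D * L)" using PS AB by (intro mult_mono) auto
    finally have "real (card (?C i)) \<le> real ((D * L) * (D * L))" by (simp only: of_nat_le_iff)
    then have "p * real (card (?C i)) \<le> p * (real D * real L)\<^sup>2"
      using p by (intro mult_left_mono) (auto simp: power2_eq_square)
    then show ?thesis using a by linarith
  qed
  define x where "x = p * N / (4 * (1 + a))"
  have x: "x = p * b * real (card T) / (8 * (1 + a))" unfolding x_def N_def using a(2) by (simp add: field_simps)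
  have "of_bool (\<not> dense_minor d V (F \<union> H)) \<le> (of_bool (real (card {i \<in> ?I. H \<inter> ?C i \<noteq> {}}) < x) :: real)" for H
  proof (cases "real (card {i \<in> ?I. H \<inter> ?C i \<noteq> {}}) < x")
    case False
    \<comment> \<open>There are at most \<open>card T / L\<close> pieces, so a number of hits
      proportional to \<open>card T\<close> means degree proportional to \<open>L\<close> in the
      quotient.\<close>
    have "card P * L = (\<Sum>S\<in>P. L)" by simp
    also have "\<dots> \<le> (\<Sum>S\<in>P. card S)" using PS by (intro sum_mono) auto
    also have "\<dots> = card (\<Union>P)" using P(2) fS by (intro card_Union_disjoint[symmetric]) auto
    also have "\<dots> \<le> card T" using PS fT by (intro card_mono) auto
    finally have "real (card P * L) \<le> real (card T)" by (simp only: of_nat_le_iff)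
    then have "p * b / (8 * (1 + a)) * real (card P * L) \<le> p * b / (8 * (1 + a)) * real (card T)"
      using p b a(2) by (intro mult_left_mono) auto
    moreover have "real d * real (card P) \<le> p * b * real L / (8 * (1 + a)) * real (card P)"
      using d by (intro mult_right_mono) auto
    moreover have "p * b * real L / (8 * (1 + a)) * real (card P) = p * b / (8 * (1 + a)) * real (card P * L)" by simp
    moreover have "p * b / (8 * (1 + a)) * real (card T) = x" by (simp add: x)
    ultimately have "real d * real (card P) \<le> real (card {i \<in> ?I. H \<inter> ?C i \<noteq> {}})" using False by linarith
    then have "real (d * card P) \<le> real (card {i \<in> ?I. H \<inter> ?C i \<noteq> {}})" by simp
    then have "d * card P \<le> card {i \<in> ?I. H \<inter> ?C i \<noteq> {}}" by (simp only: of_nat_le_iff)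
    moreover have "is_minor (UGraph P {i \<in> ?I. H \<inter> ?C i \<noteq> {}}) (UGraph V (F \<union> H))"
      using PS T(2) by (intro quotient_is_minor[OF E P(2)]) auto
    ultimately have "dense_minor d V (F \<union> H)"
      unfolding dense_minor_def using P(1) Pne
      by (intro exI[of _ P] exI[of _ "{i \<in> ?I. H \<inter> ?C i \<noteq> {}}"]) auto
    then show ?thesis by simp
  qed simp
  then have "expect p E (\<lambda>H. of_bool (\<not> dense_minor d V (F \<union> H))) \<le>
      expect p E (\<lambda>H. of_bool (real (card {i \<in> ?I. H \<inter> ?C i \<noteq> {}}) < x))"
    by (intro expect_mono[OF fE p])
  also have "\<dots> \<le> exp (- x)" unfolding x_def
  proof (rule few_hits_unlikely[OF fE fI _ _ p ac a(2) N])
    show "?C i \<subseteq> E" for i by (auto simp: between_def)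
    show "?C i \<inter> ?C j = {}" if "i \<in> ?I" "j \<in> ?I" "i \<noteq> j" for i j
      using between_determines_pair[OF P(2)] that by blast
  qed
  also have "exp (- x) \<le> exp (- (p * b * b / (4 * (1 + a))))"
  proof -
    have "p * b / (8 * (1 + a)) * (2 * b) \<le> p * b / (8 * (1 + a)) * real (card T)"
      using p b a(2) T2 by (intro mult_left_mono) auto
    moreover have "p * b / (8 * (1 + a)) * (2 * b) = p * b * b / (4 * (1 + a))" using a(2) by (simp add: field_simps)
    ultimately show ?thesis by (simp add: x)
  qed
  finally show ?thesis .
qed

section \<open>The Hadwiger number\<close>

lemma expect_two_rounds_le:
  assumes E: "finite E" and p: "0 \<le> p1" "p1 \<le> 1" "0 \<le> p2" "p2 \<le> 1" "1 - p = (1 - p1) * (1 - p2)"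
    and first: "expect p1 E (\<lambda>A. of_bool (\<not> good A)) \<le> M"
    and second: "\<And>A. good A \<Longrightarrow> expect p2 E (\<lambda>B. of_bool (bad (A \<union> B))) \<le> x" and x: "x \<ge> 0"
  shows "expect p E (\<lambda>F. of_bool (bad F)) \<le> M + x"
proof -
  have "expect p E (\<lambda>F. of_bool (bad F)) = expect p1 E (\<lambda>A. expect p2 E (\<lambda>B. of_bool (bad (A \<union> B))))"
    by (rule expect_sprinkle[OF E p])
  also have "\<dots> \<le> expect p1 E (\<lambda>A. of_bool (\<not> good A) + x)"
  proof (rule expect_mono[OF E p(1,2)])
    fix A
    have "expect p2 E (\<lambda>B. of_bool (bad (A \<union> B))) \<le> expect p2 E (\<lambda>_. 1)"
      by (rule expect_mono[OF E p(3,4)]) simp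
    then show "expect p2 E (\<lambda>B. of_bool (bad (A \<union> B))) \<le> of_bool (\<not> good A) + x"
      using second[of A] x by (cases "good A") (simp_all add: expect_const)
  qed
  also have "\<dots> = expect p1 E (\<lambda>A. of_bool (\<not> good A)) + x" by (simp add: expect_add[OF E] expect_const)
  finally show ?thesis using first by simp
qed

lemma hadwiger_ge:
  assumes "finite V" "is_minor (complete_graph t) (UGraph V F)"
  shows "t \<le> hadwiger (UGraph V F)"
  unfolding hadwiger_def using assms finite_complete_minors[of "UGraph V F"] by (intro Max_ge) auto

lemma random_subgraph_prob:
  "measure_pmf.prob (random_subgraph G p) {H. Q H} =
    1 - expect p (edges G) (\<lambda>F. of_bool (\<not> Q (UGraph (verts G) F)))"
proof -
  let ?M = "random_set p (edges G)"
  have "random_subgraph G p = map_pmf (UGraph (verts G)) ?M"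
    unfolding random_subgraph_def random_set_def by (simp add: map_pmf_comp)
  then have "measure_pmf.prob (random_subgraph G p) {H. Q H} = measure_pmf.prob ?M {F. Q (UGraph (verts G) F)}"
    by (simp add: vimage_def)
  also have "\<dots> = 1 - measure_pmf.prob ?M {F. \<not> Q (UGraph (verts G) F)}"
    using measure_pmf.prob_compl[of "{F. \<not> Q (UGraph (verts G) F)}" ?M] by (simp add: Compl_eq_Diff_UNIV[symmetric] Collect_neg_eq)
  finally show ?thesis by (simp add: prob_random_set)
qed

lemma min_degree_le_card_nbhd:
  assumes "finite_simple_graph G" "v \<in> verts G"
  shows "min_degree G \<le> card (nbhd (edges G) v)"
proof -
  have "min_degree G \<le> vertex_degree G v"
    unfolding min_degree_def using assms by (intro Min_le) (auto simp: finite_simple_graph_def)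
  then show ?thesis
    using card_incident_edges[of "edges G" "verts G" v] assms(1)
    by (simp add: vertex_degree_def finite_simple_graph_def)
qed

text \<open>A stuck exploration has made at least \<beta> k |R| queries with at most |R| positive
  answers, while more than (1 + e1) \<beta> |R| are expected or exactly so many. Since (1 + e1)
  \<beta> > 1 this is a large deviation, and \<kappa> is its rate per q / k.\<close>

lemma exploration_supercritical:
  fixes e1 :: real
  assumes e1: "e1 > 0"
  shows "\<exists>D\<ge>1. \<exists>\<alpha>>0. \<exists>\<kappa>>0. \<forall>k\<ge>1. \<forall>(V :: 'a set) E.
    finite V \<and> V \<noteq> {} \<and> E \<subseteq> [V]\<^bsup>2\<^esup> \<and> (\<forall>v\<in>V. k \<le> card (nbhd E v)) \<and> (1 + e1) / real k \<le> 1 \<longrightarrow>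
    expect ((1 + e1) / real k) E (\<lambda>A. of_bool (\<not> dense_btree D (\<alpha> * real k) V E A)) \<le> exp (- \<kappa> * real k)"
proof -
  \<comment> \<open>Saturated vertices cost at most a share \<open>c\<close> of the edge ends and
    inner edges \<open>2 * c\<close>. The factor 8 keeps (1 + e1) (1 - 3c) = 1 + 5 e1 / 8 above
    \<open>1 + s\<close>.\<close>
  define c where "c = e1 / (8 * (1 + e1))"
  define D where "D = nat \<lceil>1 / c\<rceil>"
  define \<beta> where "\<beta> = 1 - 1 / real D - 2 * c"
  define s where "s = e1 / 2"
  define \<theta> where "\<theta> = exp (- s)"
  define \<kappa> where "\<kappa> = (1 + e1) * (1 - \<theta>) - s / \<beta>"
  have c: "0 < c" "c \<le> 1 / 8" using e1 by (auto simp: c_def field_simps)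
  have D: "1 / c \<le> real D" "D \<ge> 1"
  proof -
    show *: "1 / c \<le> real D" unfolding D_def by linarith
    have "0 < 1 / c" using c by simp
    then show "D \<ge> 1" using * by linarith
  qed
  have "1 / real D \<le> c" using D c by (simp add: field_simps)
  then have \<beta>3: "1 - 3 * c \<le> \<beta>" unfolding \<beta>_def by linarith
  then have \<beta>0: "\<beta> > 0" using c by linarith
  have "(1 + e1) * (1 - 3 * c) = 1 + 5 * e1 / 8" using e1 by (simp add: c_def field_simps)
  moreover have "(1 + e1) * (1 - 3 * c) \<le> (1 + e1) * \<beta>" using \<beta>3 e1 by (intro mult_left_mono) auto
  ultimately have \<beta>1: "1 + s < (1 + e1) * \<beta>" using e1 by (simp add: s_def)
  have s0: "s > 0" using e1 by (simp add: s_def)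
  \<comment> \<open>With 1 - exp (- s) \<ge> s / (1 + s), positivity of the rate \<kappa> reduces to
    (1 + e1) \<beta> > 1 + s.\<close>
  have \<theta>1: "s / (1 + s) \<le> 1 - \<theta>"
  proof -
    have "\<theta> = 1 / exp s" by (simp add: \<theta>_def exp_minus inverse_eq_divide)
    also have "\<dots> \<le> 1 / (1 + s)" using s0 exp_ge_add_one_self[of s] by (intro divide_left_mono) auto
    finally have "\<theta> \<le> 1 / (1 + s)" .
    moreover have "s / (1 + s) = 1 - 1 / (1 + s)" using s0 by (simp add: field_simps)
    ultimately show ?thesis by linarith
  qed
  have \<kappa>0: "\<kappa> > 0"
  proof -
    have "(1 + s) / \<beta> < 1 + e1" using \<beta>1 \<beta>0 by (simp add: pos_divide_less_eq)
    then have "s / (1 + s) * ((1 + s) / \<beta>) < s / (1 + s) * (1 + e1)"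
      using s0 by (intro mult_strict_left_mono) auto
    moreover have "s / (1 + s) * ((1 + s) / \<beta>) = s / \<beta>" using s0 by simp
    ultimately have "s / \<beta> < s / (1 + s) * (1 + e1)" by linarith
    also have "\<dots> = (1 + e1) * (s / (1 + s))" by (rule mult.commute)
    also have "\<dots> \<le> (1 + e1) * (1 - \<theta>)" using \<theta>1 e1 by (intro mult_left_mono) auto
    finally show ?thesis by (simp add: \<kappa>_def)
  qed
  \<comment> \<open>Half of the density is given up for the dead trees.\<close>
  define \<gamma> where "\<gamma> = c / 2"
  have "expect ((1 + e1) / real k) E (\<lambda>A. of_bool (\<not> dense_btree D (c / 2 * real k) V E A))
      \<le> exp (- (\<kappa> * \<gamma> * \<beta>) * real k)"
    if k: "k \<ge> 1" and V: "finite V" "V \<noteq> {}" and E: "E \<subseteq> [V]\<^bsup>2\<^esup>" and deg: "\<forall>v\<in>V. k \<le> card (nbhd E v)"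
      and p1: "(1 + e1) / real k \<le> 1" for k and V :: "'a set" and E
  proof -
    define p where "p = (1 + e1) / real k"
    \<comment> \<open>\<nu> compensates one query: the mean of \<theta> to the power of the answer
      is 1 - p (1 - \<theta>), at most 1 / \<nu>.\<close>
    define \<nu> where "\<nu> = exp (p * (1 - \<theta>))"
    define M where "M = exp (- (\<kappa> * \<gamma> * \<beta>) * real k)"
    have "p * (\<theta> * \<nu>) + (1 - p) * \<nu> = (1 + - (p * (1 - \<theta>))) * \<nu>" by (simp add: algebra_simps)
    also have "\<dots> \<le> exp (- (p * (1 - \<theta>))) * \<nu>"
      by (intro mult_right_mono exp_ge_add_one_self) (simp add: \<nu>_def)
    also have "\<dots> = 1" by (simp add: \<nu>_def exp_minus)
    finally have step: "p * (\<theta> * \<nu>) + (1 - p) * \<nu> \<le> 1" .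
    have stuck: "1 \<le> M * \<theta> ^ x * \<nu> ^ q"
      if q: "\<gamma> * \<beta> * real k * real k \<le> real q" and x: "\<beta> * real k * real x \<le> real q" for x q :: nat
    proof -
      have k0: "real k > 0" using k by simp
      have "real x \<le> real q / (\<beta> * real k)" using x \<beta>0 k0 by (simp add: field_simps)
      then have "s * real x \<le> s * (real q / (\<beta> * real k))" using s0 by (intro mult_left_mono) auto
      moreover have "s * (real q / (\<beta> * real k)) = s / \<beta> * (real q / real k)" by simp
      moreover have "real q * (p * (1 - \<theta>)) = (1 + e1) * (1 - \<theta>) * (real q / real k)" by (simp add: p_def)
      ultimately have "\<kappa> * (real q / real k) \<le> real q * (p * (1 - \<theta>)) - s * real x"
        unfolding \<kappa>_def left_diff_distrib by linarith
      moreover have "\<kappa> * (\<gamma> * \<beta> * real k) \<le> \<kappa> * (real q / real k)"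
        using q k0 \<kappa>0 by (intro mult_left_mono) (auto simp: field_simps)
      ultimately have "0 \<le> - (\<kappa> * \<gamma> * \<beta>) * real k + - (s * real x) + real q * (p * (1 - \<theta>))" by simp
      then have "1 \<le> exp (- (\<kappa> * \<gamma> * \<beta>) * real k + - (s * real x) + real q * (p * (1 - \<theta>)))" by simp
      also have "\<dots> = M * exp (- (s * real x)) * exp (real q * (p * (1 - \<theta>)))"
        by (simp only: M_def exp_add)
      also have "exp (- (s * real x)) = \<theta> ^ x" by (simp add: \<theta>_def exp_of_nat_mult[symmetric] mult.commute)
      also have "exp (real q * (p * (1 - \<theta>))) = \<nu> ^ q" unfolding \<nu>_def by (rule exp_of_nat_mult)
      finally show ?thesis .
    qed
    have "expect p E (\<lambda>A. of_bool (\<not> dense_btree D ((c - \<gamma>) * real k) V E A)) \<le> M"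
    proof (rule exploration[OF V E _ D(2) k _ _ _ _ \<beta>_def \<beta>0 _ _ _ step stuck])
      show "0 \<le> p" "p \<le> 1" using e1 p1 by (auto simp: p_def)
      show "\<gamma> * \<beta> * real k * real k \<le> \<gamma> * \<beta> * real k * real k" ..
    qed (use deg c in \<open>auto simp: \<gamma>_def \<theta>_def \<nu>_def M_def\<close>)
    then show ?thesis by (simp add: p_def M_def \<gamma>_def)
  qed
  moreover have "0 < \<kappa> * \<gamma> * \<beta>" using \<kappa>0 \<beta>0 c by (simp add: \<gamma>_def)
  ultimately show ?thesis using D(2) c
    by (intro exI[of _ D] conjI exI[of _ "c / 2"] exI[of _ "\<kappa> * \<gamma> * \<beta>"]) auto
qed

text \<open>The exact second-round probability is e1 / k divided by a factor close to 1, hence the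
  range for \<open>p\<close>.\<close>

lemma sprinkling_dense_minor:
  fixes e1 \<alpha> :: real and D :: nat
  assumes e1: "e1 > 0" and \<alpha>: "\<alpha> > 0" and D: "D \<ge> 1"
  shows "\<exists>\<omega>>0. \<exists>\<tau>>0. \<forall>\<^sub>F k :: nat in sequentially. \<forall>(V :: 'a set) E F p.
    finite V \<and> E \<subseteq> [V]\<^bsup>2\<^esup> \<and> dense_btree D (\<alpha> * real k) V E F \<and> e1 / real k \<le> p \<and> p \<le> 2 * e1 / real k \<longrightarrow>
    expect p E (\<lambda>H. of_bool (\<not> dense_minor (nat \<lfloor>\<omega> * sqrt (real k)\<rfloor>) V (F \<union> H))) \<le> exp (- \<tau> * real k)"
proof -
  \<comment> \<open>Rounding gives L * L \<le> 4 k, so with p \<le> 2 e1 / k a pair of pieces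
    expects at most 8 e1 D * D new edges.\<close>
  define a where "a = 8 * e1 * (real D)\<^sup>2"
  define \<omega> where "\<omega> = e1 * \<alpha> / (8 * (1 + a))"
  define \<tau> where "\<tau> = e1 * \<alpha>\<^sup>2 / (4 * (1 + a))"
  have a0: "a \<ge> 0" using e1 by (simp add: a_def)
  have \<omega>0: "\<omega> > 0" and \<tau>0: "\<tau> > 0" using e1 \<alpha> a0 by (auto simp: \<omega>_def \<tau>_def)
  have sq: "filterlim (\<lambda>k. sqrt (real k)) at_top sequentially"
    by (rule filterlim_compose[OF sqrt_at_top filterlim_real_sequentially])
  have "\<forall>\<^sub>F k in sequentially. 4 * (real D + 1) / \<alpha> \<le> sqrt (real k)"
    "\<forall>\<^sub>F k in sequentially. 2 * e1 \<le> real k" "\<forall>\<^sub>F k :: nat in sequentially. 1 \<le> k"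
    using sq filterlim_real_sequentially eventually_ge_at_top[of 1] unfolding filterlim_at_top by auto
  then have "\<forall>\<^sub>F k :: nat in sequentially. \<forall>(V :: 'a set) E F p.
    finite V \<and> E \<subseteq> [V]\<^bsup>2\<^esup> \<and> dense_btree D (\<alpha> * real k) V E F \<and> e1 / real k \<le> p \<and> p \<le> 2 * e1 / real k \<longrightarrow>
    expect p E (\<lambda>H. of_bool (\<not> dense_minor (nat \<lfloor>\<omega> * sqrt (real k)\<rfloor>) V (F \<union> H))) \<le> exp (- \<tau> * real k)"
  proof eventually_elim
    case (elim k)
    define L where "L = nat \<lceil>sqrt (real k)\<rceil>"
    have k1: "1 \<le> sqrt (real k)" using elim(3) by simp
    have L: "sqrt (real k) \<le> real L" "real L \<le> 2 * sqrt (real k)" "L \<ge> 1"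
      using k1 unfolding L_def by linarith+
    have "real L * real L \<le> (2 * sqrt (real k)) * (2 * sqrt (real k))" using L by (intro mult_mono) auto
    then have L2: "(real L)\<^sup>2 \<le> 4 * real k" by (simp add: power2_eq_square)
    have k0: "real k > 0" using elim(3) by simp
    show ?case
    proof (intro allI impI)
      fix V :: "'a set" and E F p
      assume "finite V \<and> E \<subseteq> [V]\<^bsup>2\<^esup> \<and> dense_btree D (\<alpha> * real k) V E F \<and> e1 / real k \<le> p \<and> p \<le> 2 * e1 / real k"
      then have V: "finite V" "E \<subseteq> [V]\<^bsup>2\<^esup>" "dense_btree D (\<alpha> * real k) V E F"
        and p: "e1 / real k \<le> p" "p \<le> 2 * e1 / real k" by auto
      have p0: "0 \<le> p" using p(1) e1 k0 by (meson divide_nonneg_pos less_imp_le order_trans)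
      have "2 * e1 / real k \<le> 1" using elim(2) k0 by simp
      then have p1: "p \<le> 1" using p(2) by linarith
      have bL: "2 * (real D + 1) * real L \<le> \<alpha> * real k"
      proof -
        have "2 * (real D + 1) * real L \<le> 2 * (real D + 1) * (2 * sqrt (real k))"
          using L(2) by (intro mult_left_mono) auto
        also have "\<dots> = 4 * (real D + 1) * sqrt (real k)" by simp
        also have "\<dots> \<le> (\<alpha> * sqrt (real k)) * sqrt (real k)"
          using elim(1) \<alpha> by (intro mult_right_mono) (auto simp: field_simps)
        also have "\<dots> = \<alpha> * real k" by simp
        finally show ?thesis .
      qed
      have "p * (real D * real L)\<^sup>2 \<le> (2 * e1 / real k) * ((real D)\<^sup>2 * (4 * real k))"
        unfolding power_mult_distrib using p p0 L2 by (intro mult_mono) auto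
      also have "\<dots> = a" using k0 by (simp add: a_def)
      finally have pa: "p * (real D * real L)\<^sup>2 \<le> a" .
      have "e1 / real k * (\<alpha> * real k) * sqrt (real k) \<le> p * (\<alpha> * real k) * real L"
        using p(1) \<alpha> L(1) p0 by (intro mult_mono) auto
      then have "e1 * \<alpha> * sqrt (real k) / (8 * (1 + a)) \<le> p * (\<alpha> * real k) * real L / (8 * (1 + a))"
        using k0 a0 by (intro divide_right_mono) auto
      then have "\<omega> * sqrt (real k) \<le> p * (\<alpha> * real k) * real L / (8 * (1 + a))" by (simp add: \<omega>_def)
      moreover have "real (nat \<lfloor>\<omega> * sqrt (real k)\<rfloor>) \<le> \<omega> * sqrt (real k)"
        using \<omega>0 by (intro of_nat_floor) auto
      ultimately have d: "real (nat \<lfloor>\<omega> * sqrt (real k)\<rfloor>) \<le> p * (\<alpha> * real k) * real L / (8 * (1 + a))" by linarith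
      have "expect p E (\<lambda>H. of_bool (\<not> dense_minor (nat \<lfloor>\<omega> * sqrt (real k)\<rfloor>) V (F \<union> H)))
        \<le> exp (- (p * (\<alpha> * real k) * (\<alpha> * real k) / (4 * (1 + a))))"
        using \<alpha> k0 by (intro sprinkling[OF V(1,2) L(3) D _ V(3) bL p0 p1 pa a0 d]) simp
      also have "\<dots> \<le> exp (- \<tau> * real k)"
      proof -
        have "e1 / real k * ((\<alpha> * real k) * (\<alpha> * real k)) \<le> p * ((\<alpha> * real k) * (\<alpha> * real k))"
          using p(1) \<alpha> by (intro mult_right_mono) auto
        then have "e1 / real k * ((\<alpha> * real k) * (\<alpha> * real k)) / (4 * (1 + a)) \<le>
            p * ((\<alpha> * real k) * (\<alpha> * real k)) / (4 * (1 + a))"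
          using a0 by (intro divide_right_mono) auto
        moreover have "e1 / real k * ((\<alpha> * real k) * (\<alpha> * real k)) / (4 * (1 + a)) = \<tau> * real k"
          using k0 by (simp add: \<tau>_def power2_eq_square)
        ultimately show ?thesis by (simp add: mult.assoc)
      qed
      finally show "expect p E (\<lambda>H. of_bool (\<not> dense_minor (nat \<lfloor>\<omega> * sqrt (real k)\<rfloor>) V (F \<union> H)))
        \<le> exp (- \<tau> * real k)" .
    qed
  qed
  then show ?thesis using \<omega>0 \<tau>0 by blast
qed

lemma hadwiger_of_dense_minor:
  fixes \<omega> :: real
  assumes \<omega>: "\<omega> > 0"
  shows "\<exists>c>0. \<forall>\<^sub>F k :: nat in sequentially. \<forall>(V :: 'a set) F.
    finite V \<and> dense_minor (nat \<lfloor>\<omega> * sqrt (real k)\<rfloor>) V F \<longrightarrow>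
    c * sqrt (real k / ln (real k)) \<le> real (hadwiger (UGraph V F))"
proof -
  obtain c0 :: real where c0: "c0 > 0" and ev: "\<forall>\<^sub>F d :: nat in sequentially. \<forall>(P :: 'a set set) Q.
     finite P \<and> P \<noteq> {} \<and> Q \<subseteq> [P]\<^bsup>2\<^esup> \<and> d * card P \<le> card Q \<longrightarrow>
     (\<exists>t. c0 * real d / sqrt (ln (real d)) \<le> real t \<and> is_minor (complete_graph t) (UGraph P Q))"
    using complete_minor_of_average_degree[where 'a = "'a set"] by (elim exE conjE)
  obtain d0 where ev': "\<forall>d\<ge>d0. \<forall>(P :: 'a set set) Q.
     finite P \<and> P \<noteq> {} \<and> Q \<subseteq> [P]\<^bsup>2\<^esup> \<and> d * card P \<le> card Q \<longrightarrow>
     (\<exists>t. c0 * real d / sqrt (ln (real d)) \<le> real t \<and> is_minor (complete_graph t) (UGraph P Q))"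
    using ev unfolding eventually_sequentially by (elim exE)
  have d0: "\<And>d (P :: 'a set set) Q. d \<ge> d0 \<Longrightarrow> finite P \<Longrightarrow> P \<noteq> {} \<Longrightarrow> Q \<subseteq> [P]\<^bsup>2\<^esup> \<Longrightarrow>
      d * card P \<le> card Q \<Longrightarrow>
     (\<exists>t. c0 * real d / sqrt (ln (real d)) \<le> real t \<and> is_minor (complete_graph t) (UGraph P Q))"
    using ev' by simp
  have sq: "filterlim (\<lambda>k. sqrt (real k)) at_top sequentially"
    by (rule filterlim_compose[OF sqrt_at_top filterlim_real_sequentially])
  \<comment> \<open>The added 3 keeps \<open>d\<close> at least 2, so that ln d > 0, and at least
    half of \<omega> \<surd>k. The second condition gives d \<le> k, hence ln d \<le> ln k.\<close>
  have "\<forall>\<^sub>F k in sequentially. (real d0 + 3) / \<omega> \<le> sqrt (real k)" "\<forall>\<^sub>F k in sequentially. \<omega> \<le> sqrt (real k)"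
    using sq unfolding filterlim_at_top by auto
  then have "\<forall>\<^sub>F k :: nat in sequentially. \<forall>(V :: 'a set) F.
    finite V \<and> dense_minor (nat \<lfloor>\<omega> * sqrt (real k)\<rfloor>) V F \<longrightarrow>
    c0 * \<omega> / 2 * sqrt (real k / ln (real k)) \<le> real (hadwiger (UGraph V F))"
  proof eventually_elim
    case (elim k)
    define y where "y = \<omega> * sqrt (real k)"
    define d where "d = nat \<lfloor>y\<rfloor>"
    have y: "real d0 + 3 \<le> y" using elim(1) \<omega> by (simp add: y_def field_simps)
    have "y \<le> sqrt (real k) * sqrt (real k)" unfolding y_def using elim(2) by (intro mult_right_mono) auto
    then have yk: "y \<le> real k" by simp
    have d: "y / 2 \<le> real d" "real d \<le> y" "d \<ge> d0" "2 \<le> d" using y unfolding d_def by linarith+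
    have ln: "0 < ln (real d)" "ln (real d) \<le> ln (real k)" using d yk by auto
    have "c0 * (y / 2) / sqrt (ln (real k)) \<le> c0 * real d / sqrt (ln (real d))"
      using c0 d ln y by (intro frac_le mult_left_mono) auto
    moreover have "c0 * (y / 2) / sqrt (ln (real k)) = c0 * \<omega> / 2 * sqrt (real k / ln (real k))"
      by (simp add: y_def real_sqrt_divide)
    ultimately have final: "c0 * \<omega> / 2 * sqrt (real k / ln (real k)) \<le> c0 * real d / sqrt (ln (real d))"
      by (simp only:)
    show ?case
    proof (intro allI impI)
      fix V :: "'a set" and F
      assume "finite V \<and> dense_minor (nat \<lfloor>\<omega> * sqrt (real k)\<rfloor>) V F"
      then have V: "finite V" and m: "dense_minor d V F" by (auto simp: d_def y_def)
      obtain P :: "'a set set" and Q where P: "finite P" "P \<noteq> {}" "Q \<subseteq> [P]\<^bsup>2\<^esup>" "d * card P \<le> card Q"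
        and mi: "is_minor (UGraph P Q) (UGraph V F)"
        using m unfolding dense_minor_def by blast
      obtain t where t: "c0 * real d / sqrt (ln (real d)) \<le> real t" "is_minor (complete_graph t) (UGraph P Q)"
        using d0[OF d(3) P] by blast
      have "t \<le> hadwiger (UGraph V F)" by (rule hadwiger_ge[OF V is_minor_trans[OF t(2) mi]])
      then show "c0 * \<omega> / 2 * sqrt (real k / ln (real k)) \<le> real (hadwiger (UGraph V F))"
        using final t(1) by linarith
    qed
  qed
  then show ?thesis using c0 \<omega> by (intro exI[of _ "c0 * \<omega> / 2"]) simp
qed

theorem theorem1p2:
  fixes \<epsilon> :: real
  assumes "\<epsilon> > 0"
  shows "\<exists>c>0. \<forall>\<eta>>0. \<forall>\<^sub>F k :: nat in sequentially.
    \<forall>G :: 'a ugraph. finite_simple_graph G \<and> min_degree G \<ge> k \<longrightarrow>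
      measure_pmf.prob (random_subgraph G ((1 + \<epsilon>) / real k))
        {H. real (hadwiger H) \<ge> c * sqrt (real k / ln (real k))} \<ge> 1 - \<eta>"
proof -
  \<comment> \<open>Half of \<epsilon> keeps the first round supercritical, the other half is left
    for the second.\<close>
  define e1 where "e1 = \<epsilon> / 2"
  have e1: "e1 > 0" and \<epsilon>: "\<epsilon> = 2 * e1" using assms by (auto simp: e1_def)
  obtain D \<alpha> \<kappa> where D: "D \<ge> 1" and \<alpha>: "\<alpha> > 0" and \<kappa>: "\<kappa> > 0" and
    expl: "\<forall>k\<ge>1. \<forall>(V :: 'a set) E.
    finite V \<and> V \<noteq> {} \<and> E \<subseteq> [V]\<^bsup>2\<^esup> \<and> (\<forall>v\<in>V. k \<le> card (nbhd E v)) \<and> (1 + e1) / real k \<le> 1 \<longrightarrow>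
    expect ((1 + e1) / real k) E (\<lambda>A. of_bool (\<not> dense_btree D (\<alpha> * real k) V E A)) \<le> exp (- \<kappa> * real k)"
    using exploration_supercritical[OF e1] by (elim exE conjE)
  obtain \<omega> \<tau> where \<omega>: "\<omega> > 0" and \<tau>: "\<tau> > 0" and
    spr: "\<forall>\<^sub>F k :: nat in sequentially. \<forall>(V :: 'a set) E F p.
    finite V \<and> E \<subseteq> [V]\<^bsup>2\<^esup> \<and> dense_btree D (\<alpha> * real k) V E F \<and> e1 / real k \<le> p \<and> p \<le> 2 * e1 / real k \<longrightarrow>
    expect p E (\<lambda>H. of_bool (\<not> dense_minor (nat \<lfloor>\<omega> * sqrt (real k)\<rfloor>) V (F \<union> H))) \<le> exp (- \<tau> * real k)"
    using sprinkling_dense_minor[OF e1 \<alpha> D] by (elim exE conjE)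
  obtain c :: real where c: "c > 0" and had: "\<forall>\<^sub>F k :: nat in sequentially. \<forall>(V :: 'a set) F.
    finite V \<and> dense_minor (nat \<lfloor>\<omega> * sqrt (real k)\<rfloor>) V F \<longrightarrow>
    c * sqrt (real k / ln (real k)) \<le> real (hadwiger (UGraph V F))"
    using hadwiger_of_dense_minor[OF \<omega>] by (elim exE conjE)
  show ?thesis
  proof (intro exI[of _ c] conjI c allI impI)
    fix \<eta> :: real assume \<eta>: "\<eta> > 0"
    have small: "\<forall>\<^sub>F k :: nat in sequentially. exp (- x * real k) \<le> \<eta> / 2" if "x > 0" for x :: real
    proof -
      have "\<forall>\<^sub>F k :: nat in sequentially. - ln (\<eta> / 2) / x \<le> real k"
        using filterlim_real_sequentially unfolding filterlim_at_top by blast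
      then show ?thesis
      proof eventually_elim
        case (elim k)
        then have "- x * real k \<le> ln (\<eta> / 2)" using that by (simp add: field_simps)
        then have "exp (- x * real k) \<le> exp (ln (\<eta> / 2))" by (simp only: exp_le_cancel_iff)
        then show ?case using \<eta> by simp
      qed
    qed
    \<comment> \<open>This makes \<open>p1\<close> at most 1/2, so that division by
      \<open>1 - p1\<close> at most doubles the second-round probability and keeps it below
      1.\<close>
    have "\<forall>\<^sub>F k :: nat in sequentially. 2 * (1 + 2 * e1) \<le> real k"
      using filterlim_real_sequentially unfolding filterlim_at_top by blast
    then show "\<forall>\<^sub>F k :: nat in sequentially.
      \<forall>G :: 'a ugraph. finite_simple_graph G \<and> min_degree G \<ge> k \<longrightarrow>
        measure_pmf.prob (random_subgraph G ((1 + \<epsilon>) / real k))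
          {H. real (hadwiger H) \<ge> c * sqrt (real k / ln (real k))} \<ge> 1 - \<eta>"
      using small[OF \<kappa>] small[OF \<tau>] spr had
    proof eventually_elim
      case (elim k)
      have "0 < 2 * (1 + 2 * e1)" using e1 by simp
      then have "real k > 0" using elim(1) by (rule less_le_trans)
      then have k0: "real k > 0" "k \<ge> 1" by auto
      define p where "p = (1 + \<epsilon>) / real k"
      define p1 where "p1 = (1 + e1) / real k"
      \<comment> \<open>The solution of \<open>1 - p = (1 - p1) * (1 - p2)\<close>.\<close>
      define p2 where "p2 = (p - p1) / (1 - p1)"
      have p1: "0 \<le> p1" "p1 \<le> 1 / 2" using k0 e1 elim(1) by (auto simp: p1_def field_simps)
      have pp: "p - p1 = e1 / real k" unfolding p_def p1_def \<epsilon> by (simp add: diff_divide_distrib[symmetric])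
      have p2: "e1 / real k \<le> p2" "p2 \<le> 2 * e1 / real k"
      proof -
        have "e1 / real k / 1 \<le> e1 / real k / (1 - p1)"
          using p1 e1 k0 by (intro divide_left_mono) auto
        then show "e1 / real k \<le> p2" by (simp add: p2_def pp)
        have "e1 / real k / (1 - p1) \<le> e1 / real k / (1 / 2)"
          using p1 e1 k0 by (intro divide_left_mono) auto
        then show "p2 \<le> 2 * e1 / real k" by (simp add: p2_def pp mult.commute)
      qed
      have p2': "0 \<le> p2" "p2 \<le> 1"
      proof -
        show "0 \<le> p2" using p2(1) e1 k0 by (meson divide_nonneg_pos less_imp_le order_trans)
        have "2 * e1 / real k \<le> 1" using elim(1) e1 k0 by simp
        then show "p2 \<le> 1" using p2(2) by linarith
      qed
      have prod: "1 - p = (1 - p1) * (1 - p2)" using p1 by (simp add: p2_def field_simps)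
      show ?case
      proof (intro allI impI)
        fix G :: "'a ugraph"
        assume G: "finite_simple_graph G \<and> min_degree G \<ge> k"
        let ?V = "verts G" and ?E = "edges G"
        have V: "finite ?V" "?V \<noteq> {}" "?E \<subseteq> [?V]\<^bsup>2\<^esup>" using G by (auto simp: finite_simple_graph_def)
        have deg: "\<forall>v\<in>?V. k \<le> card (nbhd ?E v)" using G min_degree_le_card_nbhd by (metis order_trans)
        let ?bad = "\<lambda>F. \<not> c * sqrt (real k / ln (real k)) \<le> real (hadwiger (UGraph ?V F))"
        have "expect p ?E (\<lambda>F. of_bool (?bad F)) \<le> exp (- \<kappa> * real k) + exp (- \<tau> * real k)"
        proof (rule expect_two_rounds_le[where good = "dense_btree D (\<alpha> * real k) ?V ?E"])
          show "expect p1 ?E (\<lambda>A. of_bool (\<not> dense_btree D (\<alpha> * real k) ?V ?E A)) \<le> exp (- \<kappa> * real k)"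
            using expl k0(2) V deg p1 unfolding p1_def by auto
          fix A assume A: "dense_btree D (\<alpha> * real k) ?V ?E A"
          let ?d = "nat \<lfloor>\<omega> * sqrt (real k)\<rfloor>"
          have "expect p2 ?E (\<lambda>B. of_bool (?bad (A \<union> B))) \<le> expect p2 ?E (\<lambda>B. of_bool (\<not> dense_minor ?d ?V (A \<union> B)))"
            using elim(5) V(1) by (intro expect_mono[OF finite_edges[OF V(1,3)] p2']) (auto simp: of_bool_def)
          also have "\<dots> \<le> exp (- \<tau> * real k)" using elim(4) V A p2 by blast
          finally show "expect p2 ?E (\<lambda>B. of_bool (?bad (A \<union> B))) \<le> exp (- \<tau> * real k)" .
        qed (use finite_edges[OF V(1,3)] p1 p2' prod in auto)
        then have "expect p ?E (\<lambda>F. of_bool (?bad F)) \<le> \<eta>" using elim(2,3) by linarith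
        then show "measure_pmf.prob (random_subgraph G ((1 + \<epsilon>) / real k))
          {H. real (hadwiger H) \<ge> c * sqrt (real k / ln (real k))} \<ge> 1 - \<eta>"
          unfolding random_subgraph_prob p_def by simp
      qed
    qed
  qed
qed

end
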